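(* Let $k$ be a field of characteristic zero, let $R$ be an $n$-dimensional regular local domain essentially of finite type over $k$, with fraction field $K$, and let $\nu$ be a rank one Abhyankar valuation centered on $R$. Let $\Phi=\nu(R\setminus\{0\})\subseteq\mathbb{R}$ and, for $m\in\Phi$, let $\mathfrak{a}_m=\{f\in R\mid\nu(f)\ge m\}$. Then $$\mathrm{vol}_R(\nu)\ =\ \lim_{m\to\infty}\ \frac{e(\mathfrak{a}_m)}{m^n},$$ where $e(\mathfrak{a}_m)$ denotes the (Hilbert–Samuel) multiplicity of the ideal $\mathfrak{a}_m$ in $R$ and $m$ ranges over $\Phi$.
   Context: A rank one valuation centered on $R$ is an $\mathbb{R}$-valued valuation $\nu$ on $K$, trivial on $k$, taking non-negative values on $R$ and strictly positive values on the maximal ideal of $R$ (with $\nu(0)=+\infty$). Its value group $\Gamma=\nu(K^* )$ is regarded as an ordered subgroup of $\mathbb{R}$. The rational rank $\text{rat.rank}\,\nu$ is $\dim_{\mathbb{Q}}(\mathbb{Q}\otimes_{\mathbb{Z}}\Gamma)$, and $\text{trans.deg}\,\nu$ is the transcendence degree over $k$ of the residue field of the valuation ring $R_\nu$. The valuation $\nu$ is Abhyankar if $\text{trans.deg}\,\nu+\text{rat.rank}\,\nu=\dim K/k$, where $\dim K/k$ is the transcendence degree of $K$ over $k$. The volume of $\nu$ on $R$ is $$\mathrm{vol}_R(\nu)=\limsup_{m\to\infty}\frac{\mathrm{length}(R/\mathfrak{a}_m)}{m^n/n!},\qquad n=\dim R,$$ with $m$ ranging over $\Phi$. For $m>0$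 the ideals $\mathfrak{a}_m$ are primary to the maximal ideal of $R$. *)

theory Defs
  imports
    "HOL-Algebra.Algebra"
    "HOL-Library.Poly_Mapping"
    "HOL-Library.Extended_Real"
begin

text \<open>
  A domain \<open>R\<close> with fraction field \<open>K\<close> and ground field \<open>k\<close> is represented by carrier sets
  \<open>k \<subseteq> R \<subseteq> carrier K\<close> inside the ring record \<open>K\<close>; the ring \<open>R\<close> itself is the record
  \<open>K\<lparr>carrier := R\<rparr>\<close>.  Notions that make sense for an arbitrary ring are defined for an
  arbitrary ring record.
\<close>

section \<open>Rings\<close>

definition char_zero :: "('a, 'm) ring_scheme \<Rightarrow> bool" where
  "char_zero R \<longleftrightarrow> (\<forall>n::nat. n > 0 \<longrightarrow> [n] \<cdot>\<^bsub>R\<^esub> \<one>\<^bsub>R\<^esub> \<noteq> \<zero>\<^bsub>R\<^esub>)"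

definition is_fraction_field :: "('a, 'm) ring_scheme \<Rightarrow> 'a set \<Rightarrow> bool" where
  "is_fraction_field K R \<longleftrightarrow> field K \<and> subring R K \<and>
     carrier K = {a \<otimes>\<^bsub>K\<^esub> inv\<^bsub>K\<^esub> b | a b. a \<in> R \<and> b \<in> R - {\<zero>\<^bsub>K\<^esub>}}"

definition krull_dim :: "('a, 'm) ring_scheme \<Rightarrow> enat" where
  "krull_dim R = Sup {enat n | n. \<exists>P :: nat \<Rightarrow> 'a set.
     (\<forall>i\<le>n. primeideal (P i) R) \<and> (\<forall>i<n. P i \<subset> P (Suc i))}"

definition local_ring :: "('a, 'm) ring_scheme \<Rightarrow> bool" where
  "local_ring R \<longleftrightarrow> cring R \<and> (\<exists>!M. maximalideal M R)"

definition max_ideal :: "('a, 'm) ring_scheme \<Rightarrow> 'a set" where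
  "max_ideal R = (THE M. maximalideal M R)"

definition embedding_dim :: "('a, 'm) ring_scheme \<Rightarrow> enat" where
  "embedding_dim R =
     Inf {enat (card S) | S. finite S \<and> S \<subseteq> carrier R \<and> genideal R S = max_ideal R}"

definition regular_local_ring :: "('a, 'm) ring_scheme \<Rightarrow> bool" where
  "regular_local_ring R \<longleftrightarrow>
     noetherian_ring R \<and> local_ring R \<and> embedding_dim R = krull_dim R"

text \<open>
  \<open>R\<close> is a localization of a finitely generated \<open>k\<close>-algebra.  If \<open>R = W\<^sup>-\<^sup>1B\<close> with \<open>B\<close> finitely
  generated, then also \<open>R = W'\<^sup>-\<^sup>1A\<close>, where \<open>A = k[S]\<close> and \<open>W'\<close> are the images of \<open>B\<close> and \<open>W\<close> in
  \<open>R\<close>; so it is enough to localize finitely generated subalgebras of \<open>R\<close>.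
\<close>
definition ess_finite_type :: "'a set \<Rightarrow> ('a, 'm) ring_scheme \<Rightarrow> bool" where
  "ess_finite_type k R \<longleftrightarrow> (\<exists>S W. finite S \<and> S \<subseteq> carrier R \<and>
     submonoid W R \<and> W \<subseteq> generate_ring R (k \<union> S) \<and> W \<subseteq> Units R \<and>
     carrier R = {a \<otimes>\<^bsub>R\<^esub> inv\<^bsub>R\<^esub> w | a w. a \<in> generate_ring R (k \<union> S) \<and> w \<in> W})"

section \<open>Length and multiplicity\<close>

definition module_length :: "('a, 'm) ring_scheme \<Rightarrow> ('a, 'b, 'n) module_scheme \<Rightarrow> enat" where
  "module_length R M = Sup {enat n | n. \<exists>N :: nat \<Rightarrow> 'b set.
     (\<forall>i\<le>n. submodule (N i) R M) \<and> (\<forall>i<n. N i \<subset> N (Suc i))}"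

text \<open>The quotient ring \<open>R/I\<close> with its structure of an \<open>R\<close>-module, \<open>r \<cdot> (I + x) = I + r x\<close>.\<close>
definition quot_module :: "('a, 'm) ring_scheme \<Rightarrow> 'a set \<Rightarrow> ('a, 'a set) module" where
  "quot_module R I =
     ring.extend (R Quot I) (module.fields (\<lambda>r C. (I +>\<^bsub>R\<^esub> r) \<otimes>\<^bsub>R Quot I\<^esub> C))"

lemma (in cring) quot_module_is_module:
  assumes "ideal I R"
  shows "Module.module R (quot_module R I)"
proof -
  interpret ideal I R by fact
  interpret Q: cring "R Quot I" by (rule quotient_is_cring) (rule is_cring)
  interpret h: ring_hom_ring R "R Quot I" "(+>) I" by (rule rcos_ring_hom_ring)
  let ?M = "quot_module R I"
  have ops: "carrier ?M = carrier (R Quot I)" "add ?M = add (R Quot I)"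
    "\<zero>\<^bsub>?M\<^esub> = \<zero>\<^bsub>R Quot I\<^esub>"
    "\<And>r C. r \<odot>\<^bsub>?M\<^esub> C = (I +> r) \<otimes>\<^bsub>R Quot I\<^esub> C"
    by (simp_all add: quot_module_def ring.defs module.defs)
  have "abelian_group ?M"
  proof (rule abelian_groupI)
    fix C assume "C \<in> carrier ?M"
    then show "\<exists>D\<in>carrier ?M. D \<oplus>\<^bsub>?M\<^esub> C = \<zero>\<^bsub>?M\<^esub>"
      by (intro bexI[of _ "\<ominus>\<^bsub>R Quot I\<^esub> C"]) (simp_all add: ops Q.l_neg)
  qed (simp_all add: ops Q.a_ac)
  moreover have "Module.module_axioms R ?M"
    by (rule module_axioms.intro)
      (simp_all add: ops Q.l_distr Q.r_distr Q.m_assoc)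
  ultimately show ?thesis
    by (intro module.intro is_cring)
qed

text \<open>
  \<open>e(I) = lim\<^sub>t length(R/I\<^sup>t) / (t\<^sup>d/d!)\<close> with \<open>d = dim R\<close>; the power of \<open>I\<close> is taken in the monoid of
  ideals.
\<close>
definition hs_multiplicity :: "('a, 'm) ring_scheme \<Rightarrow> 'a set \<Rightarrow> ereal" where
  "hs_multiplicity R I = (let d = the_enat (krull_dim R) in
     lim (\<lambda>t::nat. ereal_of_enat (module_length R (quot_module R (I [^]\<^bsub>ideals_set R\<^esub> t)))
                     / ereal (real t ^ d / fact d)))"

section \<open>Transcendence degree and rational rank\<close>

text \<open>
  A polynomial over \<open>k\<close> in the variables \<open>S\<close> is given by a finite set \<open>F\<close> of monomials (a monomial
  is a multiset over \<open>S\<close>) with coefficients \<open>c\<close>.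
\<close>
definition alg_independent :: "('a, 'm) ring_scheme \<Rightarrow> 'a set \<Rightarrow> 'a set \<Rightarrow> bool" where
  "alg_independent L k S \<longleftrightarrow> S \<subseteq> carrier L \<and>
     (\<forall>F :: 'a multiset set. \<forall>c. finite F \<and> (\<forall>M\<in>F. set_mset M \<subseteq> S) \<and> c \<in> F \<rightarrow> k \<and>
        (\<Oplus>\<^bsub>L\<^esub>M\<in>F. c M \<otimes>\<^bsub>L\<^esub> (\<Otimes>\<^bsub>L\<^esub>s\<in>set_mset M. s [^]\<^bsub>L\<^esub> count M s)) = \<zero>\<^bsub>L\<^esub>
        \<longrightarrow> (\<forall>M\<in>F. c M = \<zero>\<^bsub>L\<^esub>))"

definition trans_deg :: "('a, 'm) ring_scheme \<Rightarrow> 'a set \<Rightarrow> enat" where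
  "trans_deg L k = Sup {enat (card S) | S. finite S \<and> alg_independent L k S}"

text \<open>
  For an additive subgroup \<open>\<Gamma>\<close> of the reals, \<open>\<rat> \<otimes>\<^sub>\<int> \<Gamma>\<close> is the \<open>\<rat>\<close>-vector space on the symbols \<open>[a]\<close>,
  \<open>a \<in> \<Gamma>\<close>, modulo the span of all \<open>[a + b] - [a] - [b]\<close>.  Its dimension is the largest number of
  vectors that are linearly independent modulo these relations.
\<close>
definition rat_scale :: "rat \<Rightarrow> (real \<Rightarrow>\<^sub>0 rat) \<Rightarrow> (real \<Rightarrow>\<^sub>0 rat)" where
  "rat_scale q = Poly_Mapping.map ((*) q)"

lemma lookup_rat_scale: "Poly_Mapping.lookup (rat_scale q p) x = q * Poly_Mapping.lookup p x"
  by (simp add: rat_scale_def Poly_Mapping.map.rep_eq when_def)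

lemma module_rat_scale: "Modules.module rat_scale"
  by unfold_locales
    (auto intro!: poly_mapping_eqI simp: lookup_rat_scale lookup_add algebra_simps)

definition tensor_relations :: "real set \<Rightarrow> (real \<Rightarrow>\<^sub>0 rat) set" where
  "tensor_relations \<Gamma> = Modules.module.span rat_scale
     {Poly_Mapping.single (a + b) 1 - Poly_Mapping.single a 1 - Poly_Mapping.single b 1
       | a b. a \<in> \<Gamma> \<and> b \<in> \<Gamma>}"

definition rational_rank :: "real set \<Rightarrow> enat" where
  "rational_rank \<Gamma> = Sup {enat (card B) | B. finite B \<and> (\<forall>p\<in>B. Poly_Mapping.keys p \<subseteq> \<Gamma>) \<and>
     (\<forall>c :: (real \<Rightarrow>\<^sub>0 rat) \<Rightarrow> rat.
        (\<Sum>p\<in>B. rat_scale (c p) p) \<in> tensor_relations \<Gamma> \<longrightarrow> (\<forall>p\<in>B. c p = 0))}"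

section \<open>Valuations\<close>

locale real_valuation = field K for K (structure) +
  fixes \<nu> :: "'a \<Rightarrow> ereal"
  assumes val_zero: "\<nu> \<zero> = \<infinity>"
    and val_finite: "\<lbrakk>x \<in> carrier K; x \<noteq> \<zero>\<rbrakk> \<Longrightarrow> \<bar>\<nu> x\<bar> \<noteq> \<infinity>"
    and val_mult: "\<lbrakk>x \<in> carrier K; y \<in> carrier K\<rbrakk> \<Longrightarrow> \<nu> (x \<otimes> y) = \<nu> x + \<nu> y"
    and val_add: "\<lbrakk>x \<in> carrier K; y \<in> carrier K\<rbrakk> \<Longrightarrow> \<nu> (x \<oplus> y) \<ge> min (\<nu> x) (\<nu> y)"

text \<open>
  If \<open>R\<close> is not a field, then positivity on the maximal ideal forces the value group to be
  nontrivial, that is, \<open>\<nu>\<close> to have rank exactly one.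
\<close>
locale rank_one_centered_valuation = real_valuation K \<nu>
  for K (structure) and \<nu> :: "'a \<Rightarrow> ereal" +
  fixes k R :: "'a set"
  assumes trivial_on_ground: "\<lbrakk>c \<in> k; c \<noteq> \<zero>\<rbrakk> \<Longrightarrow> \<nu> c = 0"
    and nonneg_on_ring: "f \<in> R \<Longrightarrow> \<nu> f \<ge> 0"
    and pos_on_max_ideal: "f \<in> max_ideal (K\<lparr>carrier := R\<rparr>) \<Longrightarrow> \<nu> f > 0"

text \<open>\<open>\<nu>(R - {0})\<close>; for a field \<open>R\<close> this is the value group.\<close>
definition value_set :: "('a, 'm) ring_scheme \<Rightarrow> ('a \<Rightarrow> ereal) \<Rightarrow> real set" where
  "value_set R \<nu> = real_of_ereal ` \<nu> ` (carrier R - {\<zero>\<^bsub>R\<^esub>})"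

definition val_ring :: "('a, 'm) ring_scheme \<Rightarrow> ('a \<Rightarrow> ereal) \<Rightarrow> ('a, 'm) ring_scheme" where
  "val_ring K \<nu> = K\<lparr>carrier := {x \<in> carrier K. \<nu> x \<ge> 0}\<rparr>"

definition val_max_ideal :: "('a, 'm) ring_scheme \<Rightarrow> ('a \<Rightarrow> ereal) \<Rightarrow> 'a set" where
  "val_max_ideal K \<nu> = {x \<in> carrier K. \<nu> x > 0}"

text \<open>The ground field of the residue field is the image of \<open>k\<close>.\<close>
definition val_trans_deg :: "('a, 'm) ring_scheme \<Rightarrow> 'a set \<Rightarrow> ('a \<Rightarrow> ereal) \<Rightarrow> enat" where
  "val_trans_deg K k \<nu> = trans_deg (val_ring K \<nu> Quot val_max_ideal K \<nu>)
     ((\<lambda>c. val_max_ideal K \<nu> +>\<^bsub>val_ring K \<nu>\<^esub> c) ` k)"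

definition abhyankar :: "('a, 'm) ring_scheme \<Rightarrow> 'a set \<Rightarrow> ('a \<Rightarrow> ereal) \<Rightarrow> bool" where
  "abhyankar K k \<nu> \<longleftrightarrow>
     val_trans_deg K k \<nu> + rational_rank (value_set K \<nu>) = trans_deg K k"

definition val_ideal :: "('a, 'm) ring_scheme \<Rightarrow> ('a \<Rightarrow> ereal) \<Rightarrow> real \<Rightarrow> 'a set" where
  "val_ideal R \<nu> m = {f \<in> carrier R. \<nu> f \<ge> ereal m}"

text \<open>The filter for \<open>m \<rightarrow> \<infinity>\<close> with \<open>m\<close> ranging over \<open>\<nu>(R - {0})\<close>.\<close>
definition values_at_top :: "('a, 'm) ring_scheme \<Rightarrow> ('a \<Rightarrow> ereal) \<Rightarrow> real filter" where
  "values_at_top R \<nu> = inf at_top (principal (value_set R \<nu>))"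

definition volume :: "('a, 'm) ring_scheme \<Rightarrow> ('a \<Rightarrow> ereal) \<Rightarrow> ereal" where
  "volume R \<nu> = (let n = the_enat (krull_dim R) in
     Limsup (values_at_top R \<nu>)
       (\<lambda>m. ereal_of_enat (module_length R (quot_module R (val_ideal R \<nu> m)))
              / ereal (m ^ n / fact n)))"

end

theory Submission
  imports Defs
begin

text \<open>
  Let the maximal ideal be generated by \<open>n = dim R\<close> elements and write \<open>in(I)\<close> for the monomials in
  them that lead an element of the ideal \<open>I\<close>.  If \<open>I\<close> contains almost all monomials, then
  \<open>length(R/I)\<close> is the number of monomials outside \<open>in(I)\<close>, and \<open>in(I) in(I') \<subseteq> in(I I')\<close>.  A monomial is
  \<open>d\<^sup>t r\<close> with all exponents of \<open>r\<close> below \<open>t\<close>; if it is not in \<open>in(I\<^sup>t)\<close>, then \<open>d\<close> is not in \<open>in(I)\<close>.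
  Hence \<open>length(R/I\<^sup>t) \<le> t\<^sup>n length(R/I)\<close>.  Applied to the powers of \<open>I\<close>, this shows that
  \<open>length(R/I\<^sup>t) / t\<^sup>n\<close> converges to its infimum, so \<open>e(I)\<close> exists and \<open>e(I) \<le> n! length(R/I)\<close>.
  On the other hand \<open>\<aa>\<^sub>m\<^sup>t \<subseteq> \<aa>\<^sub>t\<^sub>m\<close> gives \<open>vol(\<nu>) \<le> e(\<aa>\<^sub>m) / m\<^sup>n\<close> for every \<open>m > 0\<close>.  Thus
  \<open>vol(\<nu>) \<le> e(\<aa>\<^sub>m) / m\<^sup>n \<le> n! length(R/\<aa>\<^sub>m) / m\<^sup>n\<close>, and the upper limit of the right-hand side is
  \<open>vol(\<nu>)\<close>.
\<close>

section \<open>Limits\<close>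

text \<open>The limit is the infimum, as in Fekete's lemma.\<close>
lemma submultiplicative_limit:
  fixes g :: "nat \<Rightarrow> nat"
  assumes "mono g" and g: "\<And>s t. s > 0 \<Longrightarrow> t > 0 \<Longrightarrow> g (s * t) \<le> s ^ n * g t"
  obtains e :: real where "(\<lambda>t. real (g t) / real t ^ n) \<longlonglongrightarrow> e" "e \<le> real (g 1)"
proof -
  define h where "h t = real (g t) / real t ^ n" for t
  define e where "e = (INF t\<in>{0<..}. h t)"
  have bdd: "bdd_below (h ` {0<..})" by (rule bdd_belowI[of _ 0]) (auto simp: h_def)
  have le: "e \<le> h t" if "t > 0" for t
    unfolding e_def using bdd that by (intro cINF_lower) auto
  have "h \<longlonglongrightarrow> e"
  proof (rule order_tendstoI)
    fix a assume "a < e"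
    show "eventually (\<lambda>t. a < h t) sequentially"
      using eventually_gt_at_top[of 0] by eventually_elim (rule less_le_trans[OF \<open>a < e\<close> le])
  next
    fix a assume "e < a"
    then obtain t where t: "t > 0" "h t < a"
      unfolding e_def using bdd by (auto simp: cINF_less_iff)
    \<comment> \<open>The multiple \<open>(T div t + 1) * t\<close> of \<open>t\<close> is at least
      \<open>T\<close> and at most \<open>T + t\<close>. Monotonicity and submultiplicativity at
      this multiple bound \<open>h T\<close> by \<open>h t\<close> times a factor that tends to
      1.\<close>
    have bound: "h T \<le> h t * (1 + real t / real T) ^ n" if "T > 0" for T
    proof -
      have "T \<le> (T div t + 1) * t"
        using t dividend_less_times_div[of t T] by (simp add: algebra_simps)
      then have "g T \<le> (T div t + 1) ^ n * g t"
        using g[of "T div t + 1" t] t monoD[OF \<open>mono g\<close>] by (meson add_gr_0 order_trans zero_less_one)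
      then have "real (g T) \<le> real ((T div t + 1) ^ n * g t)" by (rule of_nat_mono)
      also have "\<dots> = h t * ((real (T div t) + 1) * real t) ^ n"
        using t by (simp add: h_def power_mult_distrib add.commute)
      also have "\<dots> \<le> h t * (real T + real t) ^ n"
      proof (intro mult_left_mono power_mono)
        have "real (T div t * t) \<le> real T" by (rule of_nat_mono) simp
        then show "(real (T div t) + 1) * real t \<le> real T + real t" by (simp add: algebra_simps)
      qed (auto simp: h_def)
      finally have "h T \<le> h t * (real T + real t) ^ n / real T ^ n"
        using that unfolding h_def[of T] by (intro divide_right_mono) auto
      also have "\<dots> = h t * ((real T + real t) / real T) ^ n" by (simp add: power_divide)
      also have "(real T + real t) / real T = 1 + real t / real T"
        using that by (simp add: field_simps)
      finally show ?thesis .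
    qed
    have "(\<lambda>T. h t * (1 + real t / real T) ^ n) \<longlonglongrightarrow> h t * (1 + 0) ^ n"
      by (intro tendsto_intros lim_const_over_n)
    then have "eventually (\<lambda>T. h t * (1 + real t / real T) ^ n < a) sequentially"
      using t by (intro order_tendstoD) auto
    then show "eventually (\<lambda>T. h T < a) sequentially"
      using eventually_gt_at_top[of 0] by eventually_elim (rule le_less_trans[OF bound])
  qed
  then show thesis using that[of e] le[of 1] unfolding h_def[abs_def] by simp
qed

text \<open>In the application \<open>L m\<close> is \<open>length(R/\<aa>\<^sub>m)\<close>,
  \<open>G m t\<close> is \<open>length(R/\<aa>\<^sub>m\<^sup>t)\<close> and \<open>e m\<close> is
  \<open>e(\<aa>\<^sub>m) / n!\<close>, so that \<open>V\<close> is the volume. For fixed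
  \<open>m\<close>, comparing \<open>L x\<close> with \<open>G m t\<close> for \<open>t\<close>
  close to \<open>x / m\<close> bounds \<open>V\<close> above by the term at \<open>m\<close>.
  Conversely, \<open>e m \<le> L m\<close> bounds the upper limit of these terms by
  \<open>V\<close>.\<close>

lemma volume_squeeze:
  fixes L e :: "real \<Rightarrow> real" and G :: "real \<Rightarrow> nat \<Rightarrow> real" and \<Phi> :: "real set" and n :: nat
  defines "F \<equiv> inf at_top (principal \<Phi>)"
  defines "V \<equiv> Limsup F (\<lambda>m. ereal (fact n * L m / m ^ n))"
  assumes lim: "\<And>m. m \<in> \<Phi> \<Longrightarrow> m > 0 \<Longrightarrow> (\<lambda>t. G m t / real t ^ n) \<longlonglongrightarrow> e m"
    and le: "\<And>m. m \<in> \<Phi> \<Longrightarrow> m > 0 \<Longrightarrow> e m \<le> L m"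
    and L_le: "\<And>m x t. m \<in> \<Phi> \<Longrightarrow> m > 0 \<Longrightarrow> x \<in> \<Phi> \<Longrightarrow> x \<le> real t * m \<Longrightarrow> L x \<le> G m t"
  shows "((\<lambda>m. ereal (fact n * e m / m ^ n)) \<longlongrightarrow> V) F"
proof (cases "F = bot")
  \<comment> \<open>The other case is that \<open>\<Phi>\<close> is bounded above: then every limit
    along \<open>F\<close> holds trivially.\<close>
  case False
  let ?E = "\<lambda>m. ereal (fact n * e m / m ^ n)"
  have F_pos: "eventually (\<lambda>m. m \<in> \<Phi> \<and> m > 0) F"
    unfolding F_def eventually_inf_principal
    using eventually_gt_at_top[of "0::real"] by eventually_elim auto
  have "V \<le> ?E m" if m: "m \<in> \<Phi>" "m > 0" for m
  proof -
    \<comment> \<open>The least natural number \<open>t\<close> with \<open>x \<le> t * m\<close>,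
      so that \<open>L_le\<close> applies. The quotient \<open>t x / x\<close> tends to
      \<open>1 / m\<close>.\<close>
    define t where "t x = nat \<lceil>x / m\<rceil>" for x
    have t_ge: "x / m \<le> real (t x)" for x unfolding t_def by (rule of_nat_ceiling)
    have t_le: "real (t x) \<le> x / m + 1" if "x > 0" for x
    proof -
      have "0 \<le> x / m" using that m by simp
      then have "0 \<le> \<lceil>x / m\<rceil>" by linarith
      then show ?thesis unfolding t_def by simp
    qed
    have t_lim: "((\<lambda>x. real (t x) / x) \<longlongrightarrow> 1 / m) at_top"
    proof (rule tendsto_sandwich)
      show "eventually (\<lambda>x. 1 / m \<le> real (t x) / x) at_top"
        using eventually_gt_at_top[of 0]
        by eventually_elim (use t_ge in \<open>simp add: field_simps\<close>)
      show "eventually (\<lambda>x. real (t x) / x \<le> 1 / m + 1 / x) at_top"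
        using eventually_gt_at_top[of 0]
      proof eventually_elim
        case (elim x)
        then have "real (t x) / x \<le> (x / m + 1) / x" using t_le by (intro divide_right_mono) auto
        also have "\<dots> = 1 / m + 1 / x" using elim by (simp add: field_simps)
        finally show ?case .
      qed
      have "((\<lambda>x. 1 / x) \<longlongrightarrow> (0::real)) at_top"
        using tendsto_inverse_0_at_top[OF filterlim_ident] by (simp add: inverse_eq_divide)
      from tendsto_add[OF tendsto_const this, of "1 / m"]
      show "((\<lambda>x. 1 / m + 1 / x) \<longlongrightarrow> 1 / m) at_top" by simp
    qed simp
    have "filterlim (\<lambda>x. real (t x)) at_top at_top"
    proof (rule filterlim_at_top_mono)
      show "filterlim (\<lambda>x. x / m) at_top at_top"
        using m filterlim_tendsto_pos_mult_at_top[OF tendsto_const[of "1 / m"] _ filterlim_ident]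
        by (simp add: field_simps)
    qed (use t_ge in simp)
    then have "filterlim t sequentially at_top"
      by (simp add: filterlim_sequentially_iff_filterlim_real)
    \<comment> \<open>The majorant \<open>fact n * G m (t x) / x ^ n\<close> is split into a factor
      controlled by \<open>lim\<close> and a power of \<open>t x / x\<close>.\<close>
    from filterlim_compose[OF lim[OF m] this]
    have "((\<lambda>x. fact n * ((G m (t x) / real (t x) ^ n) * (real (t x) / x) ^ n)) \<longlongrightarrow>
      fact n * (e m * (1 / m) ^ n)) at_top"
      by (intro tendsto_intros t_lim)
    then have u: "((\<lambda>x. ereal (fact n * ((G m (t x) / real (t x) ^ n) * (real (t x) / x) ^ n))) \<longlongrightarrow>
      ?E m) F"
      unfolding F_def by (intro tendsto_mono[OF inf_le1]) (simp add: power_divide)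
    have "eventually (\<lambda>x. ereal (fact n * L x / x ^ n) \<le>
      ereal (fact n * ((G m (t x) / real (t x) ^ n) * (real (t x) / x) ^ n))) F"
      using F_pos
    proof eventually_elim
      case (elim x)
      then have "0 < x / m" using m by simp
      \<comment> \<open>This allows \<open>real (t x) ^ n\<close> to be cancelled.\<close>
      then have "t x > 0" using t_ge[of x] by (metis of_nat_0_less_iff less_le_trans)
      moreover have "L x \<le> G m (t x)"
        using elim m t_ge[of x] by (intro L_le) (auto simp: field_simps)
      ultimately show ?case using elim
        by (simp add: power_divide divide_right_mono)
    qed
    then have "V \<le> Limsup F (\<lambda>x. ereal (fact n * ((G m (t x) / real (t x) ^ n) * (real (t x) / x) ^ n)))"
      unfolding V_def by (rule Limsup_mono)
    also have "\<dots> = ?E m" by (rule lim_imp_Limsup[OF False u])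
    finally show ?thesis .
  qed
  then have "eventually (\<lambda>m. V \<le> ?E m) F" using F_pos by (auto elim: eventually_mono)
  then have "V \<le> Liminf F ?E" by (rule Liminf_bounded)
  moreover have "Limsup F ?E \<le> V"
    unfolding V_def
  proof (rule Limsup_mono)
    show "eventually (\<lambda>m. ?E m \<le> ereal (fact n * L m / m ^ n)) F"
      using F_pos by eventually_elim (auto intro!: divide_right_mono mult_left_mono le)
  qed
  moreover have "Liminf F ?E \<le> Limsup F ?E" by (rule Liminf_le_Limsup[OF False])
  ultimately show ?thesis using False by (intro Liminf_eq_Limsup) auto
qed simp

section \<open>Ideals and lengths\<close>

text \<open>The correspondence theorem: image and preimage under \<open>R \<rightarrow> R/I\<close>
  are mutually inverse, inclusion-preserving maps between ideals containing \<open>I\<close> and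
  submodules of \<open>R/I\<close>. Hence they carry strict chains to strict chains.\<close>

lemma (in cring) module_length_quot_module:
  assumes "ideal I R"
  shows "module_length R (quot_module R I) =
    Sup {enat n | n. \<exists>A :: nat \<Rightarrow> 'a set.
      (\<forall>i\<le>n. ideal (A i) R \<and> I \<subseteq> A i) \<and> (\<forall>i<n. A i \<subset> A (Suc i))}"
proof -
  interpret ideal I R by fact
  interpret h: ring_hom_ring R "R Quot I" "(+>) I" by (rule rcos_ring_hom_ring)
  define M where "M = quot_module R I"
  interpret M: Module.module R M
    unfolding M_def by (rule quot_module_is_module) fact
  have "carrier (R Quot I) = (+>) I ` carrier R"
    unfolding FactRing_def A_RCOSETS_def' by auto
  then have ops: "carrier M = (+>) I ` carrier R" "add M = add (R Quot I)"
    "\<zero>\<^bsub>M\<^esub> = \<zero>\<^bsub>R Quot I\<^esub>" "\<And>r C. r \<odot>\<^bsub>M\<^esub> C = (I +> r) \<otimes>\<^bsub>R Quot I\<^esub> C"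
    by (simp_all add: M_def quot_module_def ring.defs module.defs)
  have uminus: "\<ominus>\<^bsub>M\<^esub> C = \<ominus>\<^bsub>R Quot I\<^esub> C" for C
    by (simp add: a_inv_def m_inv_def M_def quot_module_def ring.defs module.defs)
  define pre where "pre H = {r \<in> carrier R. I +> r \<in> H}" for H
  have pre_ideal: "ideal (pre H) R" "I \<subseteq> pre H" if H: "submodule H R M" for H
  proof -
    have zero: "\<zero>\<^bsub>R Quot I\<^esub> \<in> H"
      using H[unfolded submodule_def] subgroup.one_closed[of H "add_monoid M"] by (simp add: ops)
    note E = M.submoduleE[OF H]
    show "ideal (pre H) R"
    proof (rule idealI)
      show "subgroup (pre H) (add_monoid R)"
      proof (rule add.subgroupI)
        show "pre H \<noteq> {}" using zero by (auto simp: pre_def intro!: exI[of _ \<zero>])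
        show "\<ominus> a \<in> pre H" if "a \<in> pre H" for a
          using that E(3)[of "I +> a"] by (auto simp: pre_def uminus)
        show "a \<oplus> b \<in> pre H" if "a \<in> pre H" "b \<in> pre H" for a b
          using that E(5)[of "I +> a" "I +> b"] by (auto simp: pre_def ops)
      qed (auto simp: pre_def)
      show "x \<otimes> a \<in> pre H" if "a \<in> pre H" "x \<in> carrier R" for a x
        using that E(4)[of x "I +> a"] by (auto simp: pre_def ops)
      then show "a \<otimes> x \<in> pre H" if "a \<in> pre H" "x \<in> carrier R" for a x
        using that by (subst m_comm) (auto simp: pre_def)
    qed (rule ring_axioms)
    show "I \<subseteq> pre H"
    proof
      fix x assume "x \<in> I"
      moreover have "I +> x = \<zero>\<^bsub>R Quot I\<^esub>"
        using a_rcos_zero[OF ideal_axioms \<open>x \<in> I\<close>] unfolding FactRing_def by simp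
      ultimately show "x \<in> pre H" using zero by (simp add: pre_def)
    qed
  qed
  have im_pre: "(+>) I ` pre H = H" if "submodule H R M" for H
    using M.submoduleE(1)[OF that] by (auto simp: pre_def ops)
  have im_submodule: "submodule ((+>) I ` A) R M" if A: "ideal A R" for A
  proof -
    interpret A: ideal A R by fact
    show ?thesis
    proof (rule M.submoduleI)
      show "(+>) I ` A \<subseteq> carrier M" by (auto simp: ops)
      show "\<zero>\<^bsub>M\<^esub> \<in> (+>) I ` A" by (auto simp: ops simp flip: h.hom_zero)
      show "\<ominus>\<^bsub>M\<^esub> C \<in> (+>) I ` A" if "C \<in> (+>) I ` A" for C
        using that by (auto simp: uminus simp flip: h.hom_a_inv)
      show "C \<oplus>\<^bsub>M\<^esub> D \<in> (+>) I ` A" if "C \<in> (+>) I ` A" "D \<in> (+>) I ` A" for C D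
        using that by (auto simp: ops simp flip: h.hom_add)
      show "x \<odot>\<^bsub>M\<^esub> C \<in> (+>) I ` A" if "x \<in> carrier R" "C \<in> (+>) I ` A" for x C
        using that by (auto simp: ops A.I_l_closed simp flip: h.hom_mult)
    qed
  qed
  have pre_im: "pre ((+>) I ` A) = A" if A: "ideal A R" "I \<subseteq> A" for A
  proof -
    interpret A: ideal A R by fact
    have "x \<in> A" if "x \<in> carrier R" "a \<in> A" "I +> x = I +> a" for x a
    proof -
      have "x \<ominus> a \<in> I"
        using that quotient_eq_iff_same_a_r_cos[OF ideal_axioms, of x a] by auto
      then have "x \<ominus> a \<oplus> a \<in> A" using that A by auto
      moreover have "x \<ominus> a \<oplus> a = x"
        using that A.Icarr[of a] by (simp add: a_minus_def a_assoc l_neg)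
      ultimately show "x \<in> A" by simp
    qed
    then show ?thesis by (auto simp: pre_def)
  qed
  have "(\<exists>N. (\<forall>i\<le>n. submodule (N i) R M) \<and> (\<forall>i<n. N i \<subset> N (Suc i))) \<longleftrightarrow>
    (\<exists>A. (\<forall>i\<le>n. ideal (A i) R \<and> I \<subseteq> A i) \<and> (\<forall>i<n. A i \<subset> A (Suc i)))"
    (is "?l \<longleftrightarrow> ?r") for n :: nat
  proof
    assume ?l
    then obtain N where N: "\<forall>i\<le>n. submodule (N i) R M" "\<forall>i<n. N i \<subset> N (Suc i)" by blast
    have "pre (N i) \<subset> pre (N (Suc i))" if "i < n" for i
    proof -
      have *: "N i \<subset> N (Suc i)" "(+>) I ` pre (N i) = N i" "(+>) I ` pre (N (Suc i)) = N (Suc i)"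
        using N im_pre that by auto
      then have "pre (N i) \<subseteq> pre (N (Suc i))" by (auto simp: pre_def)
      moreover have "pre (N i) \<noteq> pre (N (Suc i))" using * by (metis less_irrefl)
      ultimately show ?thesis by blast
    qed
    then show ?r using N pre_ideal by (intro exI[of _ "\<lambda>i. pre (N i)"]) auto
  next
    assume ?r
    then obtain A where A: "\<forall>i\<le>n. ideal (A i) R \<and> I \<subseteq> A i" "\<forall>i<n. A i \<subset> A (Suc i)" by blast
    have chain: "(+>) I ` A i \<subset> (+>) I ` A (Suc i)" if "i < n" for i
    proof -
      have *: "A i \<subset> A (Suc i)" "pre ((+>) I ` A i) = A i" "pre ((+>) I ` A (Suc i)) = A (Suc i)"
        using A pre_im that by auto
      then have "(+>) I ` A i \<noteq> (+>) I ` A (Suc i)" by (metis less_irrefl)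
      then show ?thesis using * by blast
    qed
    have "submodule ((+>) I ` A i) R M" if "i \<le> n" for i
      using A im_submodule that by blast
    with chain show ?l by (intro exI[of _ "\<lambda>i. (+>) I ` A i"]) blast
  qed
  then show ?thesis by (simp add: module_length_def M_def)
qed

text \<open>With this colon ideal, the claim that multiplication by \<open>b\<close> maps a
  generated ideal into \<open>Q\<close> has to be checked only on generators.\<close>

lemma (in cring) ideal_colon:
  assumes "ideal Q R" "b \<in> carrier R"
  shows "ideal {a \<in> carrier R. a \<otimes> b \<in> Q} R"
proof -
  interpret Q: ideal Q R by fact
  let ?A = "{a \<in> carrier R. a \<otimes> b \<in> Q}"
  have closed: "x \<otimes> a \<in> ?A" if "x \<in> carrier R" "a \<in> ?A" for x a
    using that assms by (simp add: m_assoc Q.I_l_closed)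
  show ?thesis
  proof (rule idealI)
    show "subgroup ?A (add_monoid R)"
    proof (rule add.subgroupI)
      show "?A \<noteq> {}" using assms by (auto intro!: exI[of _ \<zero>])
    qed (use assms in \<open>auto simp: l_distr l_minus simp flip: a_inv_def\<close>)
    show "x \<otimes> a \<in> ?A" if "a \<in> ?A" "x \<in> carrier R" for a x
      using closed that by blast
    then show "a \<otimes> x \<in> ?A" if "a \<in> ?A" "x \<in> carrier R" for a x
      using that m_comm[of a x] by auto
  qed (rule ring_axioms)
qed

text \<open>Zorn's lemma for the proper ideals above \<open>I\<close>. In a noetherian ring a
  nonempty chain of ideals contains its union, so the union is again proper.\<close>

lemma (in noetherian_ring) ideal_subset_maximalideal:
  assumes "ideal I R" "I \<noteq> carrier R"
  shows "\<exists>M. maximalideal M R \<and> I \<subseteq> M"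
proof -
  define P where "P = {J. ideal J R \<and> I \<subseteq> J \<and> J \<noteq> carrier R}"
  have "\<exists>M\<in>P. \<forall>J\<in>P. M \<subseteq> J \<longrightarrow> J = M"
  proof (rule subset_Zorn)
    fix C assume C: "subset.chain P C"
    show "\<exists>U\<in>P. \<forall>J\<in>C. J \<subseteq> U"
    proof (cases "C = {}")
      case True
      then show ?thesis using assms by (auto simp: P_def)
    next
      case False
      moreover have "subset.chain {I. ideal I R} C"
        using C by (auto simp: subset.chain_def P_def)
      ultimately have "\<Union>C \<in> C" by (rule ideal_chain_is_trivial)
      then show ?thesis using C by (auto simp: subset.chain_def)
    qed
  qed
  then obtain M where M: "M \<in> P" "\<And>J. J \<in> P \<Longrightarrow> M \<subseteq> J \<Longrightarrow> J = M" by blast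
  have "maximalideal M R"
  proof (rule maximalidealI)
    show "ideal M R" "carrier R \<noteq> M" using M by (auto simp: P_def)
    fix J assume "ideal J R" "M \<subseteq> J" "J \<subseteq> carrier R"
    then show "J = M \<or> J = carrier R" using M unfolding P_def by blast
  qed
  then show ?thesis using M by (auto simp: P_def)
qed

text \<open>If the principal ideal of \<open>r\<close> were proper, it would lie in a maximal ideal,
  and the only one is \<open>max_ideal R\<close>.\<close>

lemma local_ring_unit:
  fixes R (structure)
  assumes "noetherian_ring R" "local_ring R" "r \<in> carrier R" "r \<notin> max_ideal R"
  shows "r \<in> Units R"
proof -
  interpret noetherian_ring R by fact
  interpret cring R using assms(2) by (simp add: local_ring_def)
  have "carrier R = PIdl r"
  proof (rule ccontr)
    assume "carrier R \<noteq> PIdl r"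
    then obtain M where M: "maximalideal M R" "PIdl r \<subseteq> M"
      using ideal_subset_maximalideal[of "PIdl r"] cgenideal_ideal assms by auto
    then have "max_ideal R = M"
      unfolding max_ideal_def using assms by (auto simp: local_ring_def intro!: the1_equality)
    then show False using M cgenideal_self assms by auto
  qed
  then have "\<one> \<in> PIdl r" using one_closed by metis
  then obtain s where s: "s \<in> carrier R" "s \<otimes> r = \<one>"
    unfolding cgenideal_def by auto
  then have "r \<otimes> s = \<one>" using assms(3) m_comm[of r s] by simp
  then show ?thesis using assms(3) s unfolding Units_def by blast
qed

lemma (in abelian_monoid) set_add_memI: "a \<in> A \<Longrightarrow> b \<in> B \<Longrightarrow> a \<oplus> b \<in> A <+> B"
  unfolding set_add_def' by auto

lemma (in abelian_monoid) set_add_memE: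
  assumes "x \<in> A <+>\<^bsub>G\<^esub> B"
  obtains a b where "a \<in> A" "b \<in> B" "x = a \<oplus> b"
  using assms unfolding set_add_def' by auto

lemma (in ring) ideal_subset_set_add:
  assumes "ideal A R" "ideal B R"
  shows "A \<subseteq> A <+> B" "B \<subseteq> A <+> B"
proof -
  interpret A: ideal A R by fact
  interpret B: ideal B R by fact
  show "A \<subseteq> A <+> B"
  proof
    fix a assume "a \<in> A"
    then show "a \<in> A <+> B" using set_add_memI[of a A \<zero> B] A.Icarr by simp
  qed
  show "B \<subseteq> A <+> B"
  proof
    fix b assume "b \<in> B"
    then show "b \<in> A <+> B" using set_add_memI[of \<zero> A b B] B.Icarr by simp
  qed
qed

lemma (in ring) ideals_set_simps [simp]:
  "A \<otimes>\<^bsub>ideals_set R\<^esub> B = A \<cdot> B" "\<one>\<^bsub>ideals_set R\<^esub> = carrier R"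
  "carrier (ideals_set R) = {I. ideal I R}"
  by (simp_all add: ideals_set_def)

section \<open>Leading monomials\<close>

locale local_ring_generators = cring R for R (structure) +
  fixes P :: "nat set" and y :: "nat \<Rightarrow> 'a" and M :: "'a set"
  assumes finite_P: "finite P"
    and prime_P: "\<And>p. p \<in> P \<Longrightarrow> Factorial_Ring.prime p"
    and y_closed: "\<And>p. p \<in> P \<Longrightarrow> y p \<in> carrier R"
    and M_eq: "M = Idl (y ` P)"
    and unitI: "\<And>r. r \<in> carrier R \<Longrightarrow> r \<notin> M \<Longrightarrow> r \<in> Units R"
begin

text \<open>A monomial in the generators \<open>y p\<close> is encoded by the \<open>P\<close>-smooth number with the same
  exponents; the usual order of the natural numbers is then a monomial order.\<close>
definition smooth :: "nat set" where
  "smooth = {N. N > 0 \<and> prime_factors N \<subseteq> P}"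

definition mon :: "nat \<Rightarrow> 'a" where
  "mon N = (\<Otimes>p\<in>P. y p [^] multiplicity p N)"

text \<open>A descending filtration that plays the role of the higher order terms. For smooth
  \<open>N\<close> the quotient \<open>J N / J (Suc N)\<close> is generated by the class of
  \<open>mon N\<close> and annihilated by \<open>M\<close>.\<close>

definition J :: "nat \<Rightarrow> 'a set" where
  "J N = Idl {mon b | b. b \<in> smooth \<and> b \<ge> N}"

text \<open>Leading monomials; the leading term is the one of least index, as in the theory of standard
  bases of local rings.\<close>
definition init :: "'a set \<Rightarrow> nat set" where
  "init I = {N \<in> smooth. mon N \<in> I <+> J (Suc N)}"

text \<open>This is \<open>length(R/I)\<close> as soon as \<open>I\<close> contains some
  \<open>J N\<close>. That condition also makes the set finite, whereas \<open>card\<close> would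
  return 0 on an infinite set.\<close>

definition colen :: "'a set \<Rightarrow> nat" where
  "colen I = card (smooth - init I)"

section \<open>Smooth numbers and their monomials\<close>

lemma smooth_pos: "N \<in> smooth \<Longrightarrow> N > 0"
  by (simp add: smooth_def)

lemma one_smooth: "1 \<in> smooth"
  by (simp add: smooth_def)

lemma prime_smooth: "p \<in> P \<Longrightarrow> p \<in> smooth"
  using prime_P[of p] by (auto simp: smooth_def prime_prime_factors prime_gt_0_nat)

lemma mult_smooth: "N \<in> smooth \<Longrightarrow> N' \<in> smooth \<Longrightarrow> N * N' \<in> smooth"
  by (auto simp: smooth_def prime_factors_product)

lemma mon_closed [simp]: "mon N \<in> carrier R"
  unfolding mon_def by (rule finprod_closed) (auto simp: y_closed)

lemma mon_one: "mon 1 = \<one>"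
  unfolding mon_def by (rule finprod_one_eqI) (use y_closed in auto)

lemma mon_mult:
  assumes "N > 0" "N' > 0"
  shows "mon (N * N') = mon N \<otimes> mon N'"
proof -
  have "mon (N * N') = (\<Otimes>p\<in>P. y p [^] multiplicity p N \<otimes> y p [^] multiplicity p N')"
    unfolding mon_def
  proof (rule finprod_cong')
    fix p assume p: "p \<in> P"
    then have "multiplicity p (N * N') = multiplicity p N + multiplicity p N'"
      using assms prime_P by (intro prime_elem_multiplicity_mult_distrib) auto
    then show "y p [^] multiplicity p (N * N') = y p [^] multiplicity p N \<otimes> y p [^] multiplicity p N'"
      using p y_closed by (simp add: nat_pow_mult)
  qed (auto simp: y_closed)
  also have "\<dots> = mon N \<otimes> mon N'"
    unfolding mon_def by (rule finprod_multf) (auto simp: y_closed)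
  finally show ?thesis .
qed

lemma mon_prime:
  assumes "p \<in> P"
  shows "mon p = y p"
proof -
  have "mon p = (\<Otimes>q\<in>P. if p = q then y q else \<one>)"
    unfolding mon_def
  proof (rule finprod_cong')
    fix q assume q: "q \<in> P"
    then show "y q [^] multiplicity q p = (if p = q then y q else \<one>)"
      using prime_P[OF assms] prime_P[OF q] y_closed[OF q]
      by (auto simp: prime_multiplicity_other)
  qed (auto simp: y_closed)
  also have "\<dots> = y p"
    using finprod_singleton[of p P y] assms finite_P y_closed by auto
  finally show ?thesis .
qed

section \<open>The filtration by monomial ideals\<close>

lemma ideal_J: "ideal (J N) R"
  unfolding J_def by (rule genideal_ideal) auto

lemma J_subset_carrier: "J N \<subseteq> carrier R"
  using ideal.Icarr[OF ideal_J] by blast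

lemma J_minimal: "ideal Q R \<Longrightarrow> (\<And>b. b \<in> smooth \<Longrightarrow> b \<ge> N \<Longrightarrow> mon b \<in> Q) \<Longrightarrow> J N \<subseteq> Q"
  unfolding J_def by (rule genideal_minimal) auto

lemma mon_in_J: "b \<in> smooth \<Longrightarrow> b \<ge> N \<Longrightarrow> mon b \<in> J N"
  unfolding J_def by (rule subsetD[OF genideal_self]) auto

lemma J_antimono: "N \<le> N' \<Longrightarrow> J N' \<subseteq> J N"
  by (rule J_minimal[OF ideal_J]) (auto intro: mon_in_J)

lemma J_one: "J 1 = carrier R"
proof -
  interpret ideal "J 1" R by (rule ideal_J)
  have "mon 1 \<in> J 1" by (rule mon_in_J[OF one_smooth order_refl])
  then show ?thesis unfolding mon_one by (rule one_imp_carrier)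
qed

text \<open>On generators, \<open>mon d \<otimes> mon c = mon (d * c)\<close> with
  \<open>d * c \<ge> N * N'\<close>. Two colon ideals extend this to all elements, first in the left
  factor and then in the right one.\<close>

lemma J_mult:
  assumes "a \<in> J N" "b \<in> J N'"
  shows "a \<otimes> b \<in> J (N * N')"
proof -
  have 1: "a \<otimes> mon c \<in> J (N * N')" if a: "a \<in> J N" and c: "c \<in> smooth" "c \<ge> N'" for a c
  proof -
    have "J N \<subseteq> {a \<in> carrier R. a \<otimes> mon c \<in> J (N * N')}"
    proof (rule J_minimal)
      fix d assume d: "d \<in> smooth" "d \<ge> N"
      then have "mon d \<otimes> mon c = mon (d * c)"
        using c by (simp add: mon_mult smooth_pos)
      then show "mon d \<in> {a \<in> carrier R. a \<otimes> mon c \<in> J (N * N')}"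
        using c d mult_le_mono by (auto intro!: mon_in_J mult_smooth)
    qed (auto intro!: ideal_colon ideal_J)
    then show ?thesis using a by auto
  qed
  have a: "a \<in> carrier R" using assms J_subset_carrier by auto
  have "J N' \<subseteq> {b \<in> carrier R. b \<otimes> a \<in> J (N * N')}"
    using 1[OF assms(1)] a by (intro J_minimal ideal_colon ideal_J) (auto simp: m_comm)
  then show ?thesis using a assms by (auto simp: m_comm)
qed

text \<open>A generator \<open>y p\<close> turns \<open>mon N\<close> into
  \<open>mon (p * N)\<close>, and \<open>p * N > N\<close> because \<open>p \<ge> 2\<close> and
  \<open>N > 0\<close>. Thus a leading coefficient matters only modulo \<open>M\<close>.\<close>

lemma M_mult_mon:
  assumes "r \<in> M" "N \<in> smooth"
  shows "r \<otimes> mon N \<in> J (Suc N)"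
proof -
  have "M \<subseteq> {a \<in> carrier R. a \<otimes> mon N \<in> J (Suc N)}"
    unfolding M_eq
  proof (rule genideal_minimal)
    have "y p \<otimes> mon N \<in> J (Suc N)" if p: "p \<in> P" for p
    proof -
      have "y p \<otimes> mon N = mon (p * N)"
        using p assms prime_P[OF p] by (simp add: mon_prime mon_mult smooth_pos prime_gt_0_nat)
      moreover have "Suc N \<le> p * N"
        using smooth_pos[OF assms(2)] mult_le_mono1[OF prime_ge_2_nat[OF prime_P[OF p]], of N]
        by linarith
      ultimately show ?thesis using mon_in_J[OF mult_smooth[OF prime_smooth[OF p] assms(2)]] by simp
    qed
    then show "y ` P \<subseteq> {a \<in> carrier R. a \<otimes> mon N \<in> J (Suc N)}" using y_closed by auto
  qed (auto intro!: ideal_colon ideal_J)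
  then show ?thesis using assms by auto
qed

text \<open>Among the generators of \<open>J N\<close> only \<open>mon N\<close> itself has index
  below \<open>Suc N\<close>.\<close>

lemma J_decomp:
  assumes "b \<in> J N" "N \<in> smooth"
  obtains r j where "r \<in> carrier R" "j \<in> J (Suc N)" "b = r \<otimes> mon N \<oplus> j"
proof -
  have "J N \<subseteq> PIdl (mon N) <+> J (Suc N)"
  proof (rule J_minimal)
    show "ideal (PIdl (mon N) <+> J (Suc N)) R"
      by (intro add_ideals cgenideal_ideal ideal_J) auto
    fix d assume d: "d \<in> smooth" "d \<ge> N"
    show "mon d \<in> PIdl (mon N) <+> J (Suc N)"
    proof (cases "d = N")
      case True
      then show ?thesis
        using subsetD[OF ideal_subset_set_add(1)[OF cgenideal_ideal ideal_J] cgenideal_self, of "mon N"]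
        by simp
    next
      case False
      then have "mon d \<in> J (Suc N)" using d by (auto intro: mon_in_J)
      then show ?thesis
        using ideal_subset_set_add(2)[OF cgenideal_ideal[of "mon N"] ideal_J] by auto
    qed
  qed
  then have "b \<in> PIdl (mon N) <+> J (Suc N)" using assms(1) by blast
  then obtain a j where "a \<in> PIdl (mon N)" "j \<in> J (Suc N)" "b = a \<oplus> j"
    by (rule set_add_memE)
  moreover from this(1) obtain r where "r \<in> carrier R" "a = r \<otimes> mon N"
    unfolding cgenideal_def by auto
  ultimately show thesis using that by simp
qed

text \<open>Lets the division algorithm pass over indices that encode no monomial.\<close>

lemma J_not_smooth: "N \<notin> smooth \<Longrightarrow> J N = J (Suc N)"
proof
  assume "N \<notin> smooth"
  then show "J N \<subseteq> J (Suc N)"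
    by (intro J_minimal ideal_J mon_in_J) (metis Suc_leI le_neq_implies_less)+
qed (rule J_antimono, simp)

section \<open>Leading monomials of ideals and their products\<close>

text \<open>Both \<open>mon N\<close> and \<open>r\<close> lie in \<open>J N\<close>, hence so does
  \<open>f\<close>. This extra membership controls the cross terms in products.\<close>

lemma initE:
  assumes "N \<in> init I" "ideal I R"
  obtains f r where "f \<in> I" "f \<in> J N" "r \<in> J (Suc N)" "mon N = f \<oplus> r" "N \<in> smooth"
proof -
  obtain f r where fr: "f \<in> I" "r \<in> J (Suc N)" "mon N = f \<oplus> r" and N: "N \<in> smooth"
    using assms(1) unfolding init_def by (auto elim: set_add_memE)
  have c: "f \<in> carrier R" "r \<in> carrier R" using fr assms J_subset_carrier ideal.Icarr by auto
  interpret J: ideal "J N" R by (rule ideal_J)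
  have "r \<in> J N" using fr J_antimono[of N "Suc N"] by auto
  then have "mon N \<ominus> r \<in> J N" using N by (simp add: mon_in_J a_minus_def)
  also have "mon N \<ominus> r = f" unfolding fr using c by algebra
  finally show thesis using that fr N by blast
qed

lemma initI: "f \<in> I \<Longrightarrow> r \<in> J (Suc N) \<Longrightarrow> mon N = f \<oplus> r \<Longrightarrow> N \<in> smooth \<Longrightarrow> N \<in> init I"
  unfolding init_def by (auto intro: set_add_memI)

text \<open>Expanding \<open>(f \<oplus> r) \<otimes> (f' \<oplus> r')\<close> gives
  \<open>f \<otimes> f'\<close>, which lies in the product ideal, and three terms with a factor
  \<open>r\<close> or \<open>r'\<close>. As \<open>f\<close> and \<open>f'\<close> lie in
  \<open>J N\<close> and \<open>J N'\<close>, these three terms have order greater than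
  \<open>N * N'\<close>.\<close>

lemma init_mult:
  assumes "ideal I R" "ideal I' R" "N \<in> init I" "N' \<in> init I'"
  shows "N * N' \<in> init (I \<cdot> I')"
proof -
  obtain f r where f: "f \<in> I" "f \<in> J N" "r \<in> J (Suc N)" "mon N = f \<oplus> r" "N \<in> smooth"
    using initE assms by metis
  obtain f' r' where f': "f' \<in> I'" "f' \<in> J N'" "r' \<in> J (Suc N')" "mon N' = f' \<oplus> r'" "N' \<in> smooth"
    using initE assms by metis
  note c = f(2,3)[THEN J_subset_carrier[THEN subsetD]] f'(2,3)[THEN J_subset_carrier[THEN subsetD]]
  have pos: "N > 0" "N' > 0" using f f' smooth_pos by auto
  interpret J: ideal "J (Suc (N * N'))" R by (rule ideal_J)
  have "f \<otimes> r' \<in> J (N * Suc N')" "r \<otimes> f' \<in> J (Suc N * N')" "r \<otimes> r' \<in> J (Suc N * Suc N')"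
    using f f' J_mult by blast+
  moreover have "Suc (N * N') \<le> N * Suc N'" "Suc (N * N') \<le> Suc N * N'" "Suc (N * N') \<le> Suc N * Suc N'"
    using pos by auto
  ultimately have "f \<otimes> r' \<in> J (Suc (N * N'))" "r \<otimes> f' \<in> J (Suc (N * N'))" "r \<otimes> r' \<in> J (Suc (N * N'))"
    using J_antimono by blast+
  then have "f \<otimes> r' \<oplus> r \<otimes> f' \<oplus> r \<otimes> r' \<in> J (Suc (N * N'))" by simp
  moreover have "mon (N * N') = f \<otimes> f' \<oplus> (f \<otimes> r' \<oplus> r \<otimes> f' \<oplus> r \<otimes> r')"
    using c pos by (simp add: mon_mult f(4) f'(4)) algebra
  moreover have "f \<otimes> f' \<in> I \<cdot> I'" using f f' ideal_prod.prod by metis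
  ultimately show ?thesis using f f' by (auto intro!: initI mult_smooth)
qed

lemma init_carrier: "init (carrier R) = smooth"
  using subsetD[OF ideal_subset_set_add(1)[OF oneideal ideal_J] mon_closed] by (auto simp: init_def)

text \<open>The case \<open>I' = R\<close> of the product rule: leading monomials are closed under
  multiples.\<close>

lemma init_smooth_mult:
  assumes "ideal I R" "N \<in> init I" "C \<in> smooth"
  shows "N * C \<in> init I"
  using init_mult[OF assms(1) oneideal assms(2)] assms(3) ideal_prod_one[OF assms(1)] init_carrier
  by simp

lemma init_mono: "I \<subseteq> I' \<Longrightarrow> init I \<subseteq> init I'"
  unfolding init_def by (auto intro!: set_add_memI elim!: set_add_memE)

lemma init_of_J: "ideal I R \<Longrightarrow> J N0 \<subseteq> I \<Longrightarrow> N \<in> smooth \<Longrightarrow> N \<ge> N0 \<Longrightarrow> N \<in> init I"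
  using mon_in_J[of N N0] ideal_subset_set_add(1)[OF _ ideal_J, of I "Suc N"] by (auto simp: init_def)

lemma finite_colen: "ideal I R \<Longrightarrow> J N0 \<subseteq> I \<Longrightarrow> finite (smooth - init I)"
  by (rule finite_subset[of _ "{..<N0}"]) (auto simp: not_less[symmetric] intro: init_of_J)

text \<open>Division algorithm: successive leading monomials of an element of the larger ideal are
  cancelled by elements of the smaller one.\<close>
lemma init_strict_mono:
  assumes A: "ideal A R" and B: "ideal B R" and "A \<subset> B" and N0: "J N0 \<subseteq> A"
  shows "init A \<subset> init B"
proof (rule ccontr)
  assume "\<not> init A \<subset> init B"
  with init_mono[of A B] assms have eq: "init B = init A" by auto
  interpret A: ideal A R by fact
  interpret B: ideal B R by fact
  \<comment> \<open>The remainder \<open>b'\<close> stays in \<open>B\<close> and is congruent to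
    \<open>b\<close> modulo \<open>A\<close>, while its order exceeds \<open>n\<close>. The
    induction can start with \<open>b' = b\<close> because \<open>J 1\<close> is the whole
    ring.\<close>
  have reduce: "\<exists>b'. b' \<in> B \<and> b' \<in> J (Suc n) \<and> b \<ominus> b' \<in> A" if b: "b \<in> B" for b n
  proof (induction n)
    case 0
    then show ?case using b J_one by (intro exI[of _ b]) (auto simp: a_minus_def r_neg)
  next
    case (Suc n)
    then obtain b' where b': "b' \<in> B" "b' \<in> J (Suc n)" "b \<ominus> b' \<in> A" by blast
    let ?N = "Suc n"
    interpret J: ideal "J (Suc ?N)" R by (rule ideal_J)
    have bc: "b \<in> carrier R" "b' \<in> carrier R" using b b' by auto
    show ?case
    proof (cases "?N \<in> smooth")
      case False
      then show ?thesis using b' J_not_smooth by blast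
    next
      case True
      then obtain r j where r: "r \<in> carrier R" "j \<in> J (Suc ?N)" "b' = r \<otimes> mon ?N \<oplus> j"
        using J_decomp b' by blast
      show ?thesis
      proof (cases "r \<in> M")
        case True
        then have "b' \<in> J (Suc ?N)" using r M_mult_mon \<open>?N \<in> smooth\<close> by simp
        then show ?thesis using b' by blast
      next
        case False
        then have u: "r \<in> Units R" using unitI r by blast
        \<comment> \<open>Dividing \<open>b'\<close> by its unit coefficient \<open>r\<close>
          exhibits \<open>mon ?N\<close> as a leading monomial of \<open>B\<close>, hence of
          \<open>A\<close>. Subtracting \<open>r\<close> times the corresponding \<open>f\<close> in
          \<open>A\<close> then cancels the leading term of \<open>b'\<close>.\<close>
        define s where "s = inv r"
        have s: "s \<in> carrier R" "s \<otimes> r = \<one>" "r \<otimes> s = \<one>" using u by (auto simp: s_def)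
        have jc: "j \<in> carrier R" using r by auto
        have "s \<otimes> b' = s \<otimes> r \<otimes> mon ?N \<oplus> s \<otimes> j"
          unfolding r(3) using s(1) r(1) jc mon_closed[of ?N] by algebra
        then have "mon ?N = s \<otimes> b' \<ominus> s \<otimes> j"
          unfolding s(2) using s(1) jc bc mon_closed[of ?N] by algebra
        moreover have "\<ominus> (s \<otimes> j) \<in> J (Suc ?N)" using s r by (simp add: J.I_l_closed)
        ultimately have "?N \<in> init B"
          using s b' \<open>?N \<in> smooth\<close> by (intro initI[of "s \<otimes> b'"]) (auto simp: B.I_l_closed a_minus_def)
        then have "?N \<in> init A" using eq by simp
        then obtain f g where f: "f \<in> A" "g \<in> J (Suc ?N)" "mon ?N = f \<oplus> g"
          using initE[OF _ A] by metis
        have fc: "f \<in> carrier R" "g \<in> carrier R" using f by auto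
        have "b' \<ominus> r \<otimes> f = r \<otimes> g \<oplus> j"
          unfolding r(3) f(3) using fc jc r(1) by algebra
        then have "b' \<ominus> r \<otimes> f \<in> J (Suc ?N)" using r f by (simp add: J.I_l_closed)
        moreover have "b' \<ominus> r \<otimes> f \<in> B"
          using b' r f assms by (auto simp: a_minus_def B.I_l_closed)
        moreover have "b \<ominus> (b' \<ominus> r \<otimes> f) = (b \<ominus> b') \<oplus> r \<otimes> f"
          using bc r(1) fc by algebra
        then have "b \<ominus> (b' \<ominus> r \<otimes> f) \<in> A" using b' r f by (simp add: A.I_l_closed)
        ultimately show ?thesis by blast
      qed
    qed
  qed
  have "b \<in> A" if b: "b \<in> B" for b
  proof -
    \<comment> \<open>Reduction may stop here: a remainder of order beyond \<open>N0\<close> already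
      belongs to \<open>A\<close>.\<close>
    obtain b' where b': "b' \<in> J (Suc N0)" "b \<ominus> b' \<in> A" using reduce[OF b] by metis
    then have "b' \<in> A" using N0 J_antimono[of N0 "Suc N0"] by auto
    then have "b \<ominus> b' \<oplus> b' \<in> A" using b' by simp
    moreover have "b \<ominus> b' \<oplus> b' = b" using b \<open>b' \<in> A\<close> A.Icarr B.Icarr by algebra
    ultimately show "b \<in> A" by simp
  qed
  then show False using assms by auto
qed

section \<open>Colength as length\<close>

lemma init_subset_smooth: "init I \<subseteq> smooth"
  by (auto simp: init_def)

lemma colen_antimono:
  assumes "ideal A R" "J N0 \<subseteq> A" "A \<subseteq> B"
  shows "colen B \<le> colen A"
  unfolding colen_def using finite_colen[OF assms(1,2)] init_mono[OF assms(3)]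
  by (auto intro!: card_mono)

lemma colen_strict_antimono:
  assumes "ideal A R" "ideal B R" "A \<subset> B" "J N0 \<subseteq> A"
  shows "colen B < colen A"
  unfolding colen_def
  using finite_colen[OF assms(1,4)] init_strict_mono[OF assms] init_subset_smooth[of B]
  by (intro psubset_card_mono) auto

text \<open>Every strict inclusion in the chain lowers \<open>colen\<close> by at least one.\<close>

lemma chain_le_colen:
  assumes I: "ideal I R" "J N0 \<subseteq> I"
    and A: "\<And>i. i \<le> n \<Longrightarrow> ideal (A i) R \<and> I \<subseteq> A i" "\<And>i. i < n \<Longrightarrow> A i \<subset> A (Suc i)"
  shows "n \<le> colen I"
proof -
  have "colen (A i) + i \<le> colen I" if "i \<le> n" for i
    using that
  proof (induction i)
    case 0
    then show ?case using colen_antimono[OF I, of "A 0"] A(1)[of 0] by simp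
  next
    case (Suc i)
    then have "colen (A (Suc i)) < colen (A i)"
      using A(1)[of i] A(1)[of "Suc i"] A(2)[of i] I by (intro colen_strict_antimono[of _ _ N0]) auto
    then show ?case using Suc by simp
  qed
  from this[of n] show ?thesis by simp
qed

text \<open>Starting from \<open>I\<close>, the ideals \<open>I <+> J N\<close> are taken for the
  monomials \<open>N\<close> outside \<open>init I\<close> in decreasing order. Each step is strict
  because it adds \<open>mon N\<close>, which is not in \<open>I <+> J (Suc N)\<close>, while the
  preceding ideal is contained there.\<close>

lemma colen_chain:
  assumes I: "ideal I R" "J N0 \<subseteq> I"
  obtains A where "\<And>i. i \<le> colen I \<Longrightarrow> ideal (A i) R \<and> I \<subseteq> A i"
    "\<And>i. i < colen I \<Longrightarrow> A i \<subset> A (Suc i)"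
proof -
  define c where "c = rev (sorted_list_of_set (smooth - init I))"
  note fin = finite_colen[OF I]
  have len: "length c = colen I" using fin by (simp add: c_def colen_def)
  have c_mem: "c ! i \<in> smooth - init I" if "i < colen I" for i
    using nth_mem[of i c] that fin len by (auto simp: c_def)
  have c_less: "Suc (c ! Suc i) \<le> c ! i" if "Suc i < colen I" for i
  proof -
    have "sorted_wrt (<) (rev c)" by (simp add: c_def)
    then have "sorted_wrt (>) c" by (simp add: sorted_wrt_rev)
    then show ?thesis using that len sorted_wrt_nth_less[of "(>)" c i "Suc i"] by simp
  qed
  \<comment> \<open>The index is shifted by one: \<open>A 0\<close> is \<open>I\<close>, and
    \<open>A (Suc j)\<close> is the first ideal containing \<open>mon (c ! j)\<close>.\<close>
  define A where "A i = (case i of 0 \<Rightarrow> I | Suc j \<Rightarrow> I <+> J (c ! j))" for i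
  have *: "ideal (A i) R \<and> I \<subseteq> A i" for i
    using I ideal_subset_set_add(1)[OF I(1) ideal_J]
    by (auto simp: A_def split: nat.split intro!: add_ideals ideal_J)
  have "A i \<subset> A (Suc i)" if i: "i < colen I" for i
  proof -
    have N: "c ! i \<in> smooth" "mon (c ! i) \<notin> I <+> J (Suc (c ! i))"
      using c_mem[OF i] by (auto simp: init_def)
    have sub: "A i \<subseteq> I <+> J (Suc (c ! i))"
    proof (cases i)
      case 0
      then show ?thesis using ideal_subset_set_add(1)[OF I(1) ideal_J] by (simp add: A_def)
    next
      case (Suc j)
      then have "J (c ! j) \<subseteq> J (Suc (c ! i))" using c_less[of j] i by (intro J_antimono) simp
      then show ?thesis using Suc by (auto simp: A_def intro!: set_add_memI elim!: set_add_memE)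
    qed
    have "J (Suc (c ! i)) \<subseteq> J (c ! i)" by (rule J_antimono) simp
    then have "I <+>\<^bsub>R\<^esub> J (Suc (c ! i)) \<subseteq> I <+>\<^bsub>R\<^esub> J (c ! i)"
      by (auto intro!: set_add_memI elim!: set_add_memE)
    moreover have "mon (c ! i) \<in> I <+> J (c ! i)"
      using subsetD[OF ideal_subset_set_add(2)[OF I(1) ideal_J] mon_in_J] N by blast
    ultimately show ?thesis using sub N by (auto simp: A_def)
  qed
  with * show thesis using that by blast
qed

text \<open>\<open>chain_le_colen\<close> bounds the length of every chain, and
  \<open>colen_chain\<close> attains the bound.\<close>

lemma module_length_eq_colen:
  assumes I: "ideal I R" "J N0 \<subseteq> I"
  shows "module_length R (quot_module R I) = enat (colen I)"
proof -
  obtain A where "\<And>i. i \<le> colen I \<Longrightarrow> ideal (A i) R \<and> I \<subseteq> A i"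
    "\<And>i. i < colen I \<Longrightarrow> A i \<subset> A (Suc i)"
    using colen_chain[OF I] by metis
  then have "enat (colen I) \<in> {enat n | n. \<exists>A :: nat \<Rightarrow> 'a set.
      (\<forall>i\<le>n. ideal (A i) R \<and> I \<subseteq> A i) \<and> (\<forall>i<n. A i \<subset> A (Suc i))}" by blast
  moreover have "x \<le> enat (colen I)" if x: "x \<in> {enat n | n. \<exists>A :: nat \<Rightarrow> 'a set.
      (\<forall>i\<le>n. ideal (A i) R \<and> I \<subseteq> A i) \<and> (\<forall>i<n. A i \<subset> A (Suc i))}" for x
  proof -
    obtain n A where *: "x = enat n" "\<forall>i\<le>n. ideal (A i) R \<and> I \<subseteq> A i" "\<forall>i<n. A i \<subset> A (Suc i)"
      using x by blast
    then show ?thesis using chain_le_colen[OF I, of n A] by simp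
  qed
  ultimately show ?thesis
    unfolding module_length_quot_module[OF I(1)] by (intro antisym Sup_least Sup_upper)
qed

section \<open>Powers of ideals\<close>

abbreviation ideal_pow :: "'a set \<Rightarrow> nat \<Rightarrow> 'a set" where
  "ideal_pow I t \<equiv> I [^]\<^bsub>ideals_set R\<^esub> t"

lemma ideal_ideal_pow: "ideal I R \<Longrightarrow> ideal (ideal_pow I t) R"
  by (induction t) (auto simp: oneideal ideal_prod_is_ideal)

lemma ideal_pow_1: "ideal I R \<Longrightarrow> ideal_pow I 1 = I"
  using ideal_prod_commute[OF oneideal, of I] ideal_prod_one[of I]
  by simp

lemma ideal_pow_mult: "ideal I R \<Longrightarrow> ideal_pow I (t * s) = ideal_pow (ideal_pow I t) s"
proof -
  assume "ideal I R"
  interpret S: comm_monoid "ideals_set R" by (rule ideals_set_is_comm_monoid)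
  show ?thesis using S.nat_pow_pow[of I t s] \<open>ideal I R\<close> by simp
qed

lemma ideal_pow_antimono:
  assumes "ideal I R" "s \<le> t"
  shows "ideal_pow I t \<subseteq> ideal_pow I s"
  using assms(2)
proof (induction t rule: dec_induct)
  case (step t)
  then show ?case
    using ideal_prod_inter[OF ideal_ideal_pow[OF assms(1)] assms(1), of t] by auto
qed simp

lemma init_pow: "ideal I R \<Longrightarrow> D \<in> init I \<Longrightarrow> D ^ t \<in> init (ideal_pow I t)"
proof (induction t)
  case 0
  then show ?case using one_smooth by (simp add: init_carrier)
next
  case (Suc t)
  then show ?case using init_mult[OF ideal_ideal_pow[OF Suc(2)] Suc(2), of "D ^ t" t D]
    by (simp add: mult.commute)
qed

lemma mon_pow_mem: "D > 0 \<Longrightarrow> mon D \<in> I \<Longrightarrow> mon (D ^ t) \<in> ideal_pow I t"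
proof (induction t)
  case (Suc t)
  then have "mon (D ^ t) \<otimes> mon D \<in> ideal_pow I t \<cdot> I" by (blast intro: ideal_prod.prod)
  moreover have "mon (D ^ t) \<otimes> mon D = mon (D ^ t * D)" using Suc by (simp add: mon_mult)
  ultimately show ?case by (simp add: mult.commute)
qed simp

section \<open>Smooth numbers and t-th powers\<close>

lemma power_smooth: "N \<in> smooth \<Longrightarrow> N ^ t \<in> smooth"
  by (induction t) (use one_smooth mult_smooth in auto)

lemma prod_power_smooth: "(\<Prod>p\<in>P. p ^ f p) \<in> smooth"
proof -
  have "(\<Prod>p\<in>Q. p ^ f p) \<in> smooth" if "finite Q" "Q \<subseteq> P" for Q
    using that
  proof (induction Q rule: finite_induct)
    case empty
    then show ?case using one_smooth by simp
  next
    case (insert p Q)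
    then show ?case by (simp add: mult_smooth power_smooth prime_smooth)
  qed
  then show ?thesis using finite_P by blast
qed

lemma smooth_eq_prod:
  assumes "N \<in> smooth"
  shows "N = (\<Prod>p\<in>P. p ^ multiplicity p N)"
proof -
  have "N = (\<Prod>p\<in>prime_factors N. p ^ multiplicity p N)"
    using assms by (intro prime_factorization_nat) (simp add: smooth_def)
  also have "\<dots> = (\<Prod>p\<in>P. p ^ multiplicity p N)"
    using assms finite_P prime_P
    by (intro prod.mono_neutral_left) (auto simp: smooth_def prime_factors_multiplicity)
  finally show ?thesis .
qed

text \<open>The smooth numbers with all exponents below \<open>t\<close>. Describing them by
  extensional functions makes their number at most \<open>t ^ card P\<close>.\<close>

definition power_free :: "nat \<Rightarrow> nat set" where
  "power_free t = (\<lambda>f. \<Prod>p\<in>P. p ^ f p) ` (P \<rightarrow>\<^sub>E {..<t})"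

lemma finite_power_free: "finite (power_free t)"
  unfolding power_free_def by (intro finite_imageI finite_PiE finite_P) auto

lemma card_power_free: "card (power_free t) \<le> t ^ card P"
  unfolding power_free_def
  by (rule order_trans[OF card_image_le]) (auto simp: finite_P finite_PiE card_PiE)

lemma power_free_smooth: "E \<in> power_free t \<Longrightarrow> E \<in> smooth"
  by (auto simp: power_free_def prod_power_smooth)

text \<open>Division of every exponent by \<open>t\<close> puts the quotients into \<open>D\<close>
  and the remainders into \<open>E\<close>.\<close>

lemma smooth_decomp:
  assumes "N \<in> smooth" "t > 0"
  obtains D E where "D \<in> smooth" "E \<in> power_free t" "N = D ^ t * E"
proof
  let ?D = "\<Prod>p\<in>P. p ^ (multiplicity p N div t)"
  let ?f = "restrict (\<lambda>p. multiplicity p N mod t) P"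
  show "?D \<in> smooth" by (rule prod_power_smooth)
  show "(\<Prod>p\<in>P. p ^ ?f p) \<in> power_free t"
    unfolding power_free_def using assms by (intro imageI) auto
  have "?D ^ t * (\<Prod>p\<in>P. p ^ ?f p) = (\<Prod>p\<in>P. p ^ multiplicity p N)"
    by (simp add: prod_power_distrib prod.distrib [symmetric] power_mult [symmetric] power_add [symmetric]
        cong: prod.cong)
  then show "N = ?D ^ t * (\<Prod>p\<in>P. p ^ ?f p)" using smooth_eq_prod[OF assms(1)] by simp
qed

text \<open>A form of Lech's inequality \<open>e(I) \<le> n! length(R/I)\<close>.\<close>
lemma colen_ideal_pow_le:
  assumes I: "ideal I R" "J N0 \<subseteq> I" and "t > 0"
  shows "colen (ideal_pow I t) \<le> t ^ card P * colen I"
proof -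
  have "smooth - init (ideal_pow I t) \<subseteq>
    (\<lambda>(D, E). D ^ t * E) ` ((smooth - init I) \<times> power_free t)"
  proof
    fix N assume N: "N \<in> smooth - init (ideal_pow I t)"
    then obtain D E where DE: "D \<in> smooth" "E \<in> power_free t" "N = D ^ t * E"
      using smooth_decomp \<open>t > 0\<close> by blast
    have "D \<notin> init I"
      using N init_smooth_mult[OF ideal_ideal_pow[OF I(1)] init_pow[OF I(1)] power_free_smooth[OF DE(2)]]
      unfolding DE(3) by blast
    then show "N \<in> (\<lambda>(D, E). D ^ t * E) ` ((smooth - init I) \<times> power_free t)"
      using DE by force
  qed
  then have "colen (ideal_pow I t) \<le> card ((\<lambda>(D, E). D ^ t * E) ` ((smooth - init I) \<times> power_free t))"
    unfolding colen_def using finite_colen[OF I] finite_power_free by (intro card_mono) auto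
  also have "\<dots> \<le> card ((smooth - init I) \<times> power_free t)"
    using finite_colen[OF I] finite_power_free by (intro card_image_le) auto
  also have "\<dots> = colen I * card (power_free t)" by (simp add: card_cartesian_product colen_def)
  also have "\<dots> \<le> t ^ card P * colen I" using card_power_free[of t] by simp
  finally show ?thesis .
qed

text \<open>In a decomposition \<open>b = D ^ t * E\<close> the factor \<open>E\<close> is bounded,
  so a large \<open>b\<close> forces \<open>D \<ge> N0\<close>. Then \<open>mon D\<close> is in
  \<open>I\<close>, and \<open>mon b\<close> is a multiple of its \<open>t\<close>-th power.\<close>

lemma J_subset_ideal_pow:
  assumes I: "ideal I R" "J N0 \<subseteq> I"
  shows "\<exists>N. J N \<subseteq> ideal_pow I t"
proof (cases "t = 0")
  case True
  then show ?thesis using J_subset_carrier by auto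
next
  case False
  interpret It: ideal "ideal_pow I t" R by (rule ideal_ideal_pow[OF I(1)])
  define B where "B = Max (power_free t)"
  have "J (Suc (N0 ^ t * B)) \<subseteq> ideal_pow I t"
  proof (rule J_minimal[OF It.ideal_axioms])
    fix b assume b: "b \<in> smooth" "Suc (N0 ^ t * B) \<le> b"
    then obtain D E where DE: "D \<in> smooth" "E \<in> power_free t" "b = D ^ t * E"
      using smooth_decomp False by blast
    have "E \<le> B" unfolding B_def using DE finite_power_free by simp
    have "N0 \<le> D"
    proof (rule ccontr)
      assume "\<not> N0 \<le> D"
      then have "D ^ t * E \<le> N0 ^ t * B" using \<open>E \<le> B\<close> by (intro mult_le_mono power_mono) auto
      then show False using b DE by simp
    qed
    then have "mon (D ^ t) \<in> ideal_pow I t"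
      using mon_in_J[OF DE(1)] I by (intro mon_pow_mem smooth_pos DE) auto
    moreover have "mon b = mon (D ^ t) \<otimes> mon E"
      unfolding DE(3) using DE smooth_pos power_free_smooth by (intro mon_mult) auto
    ultimately show "mon b \<in> ideal_pow I t" by (simp add: It.I_r_closed)
  qed
  then show ?thesis by blast
qed

end

text \<open>Since \<open>I\<^sup>s\<^sup>t\<close> is the \<open>s\<close>-th power of
  \<open>I\<^sup>t\<close>, the bound on colengths of powers makes
  \<open>t \<mapsto> colen (ideal_pow I t)\<close> submultiplicative in the sense of
  \<open>submultiplicative_limit\<close>.\<close>

lemma (in local_ring_generators) multiplicity_eq_limit:
  assumes I: "ideal I R" "J N0 \<subseteq> I" and "krull_dim R = enat (card P)"
  obtains e where "hs_multiplicity R I = ereal (fact (card P) * e)"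
    "(\<lambda>t. real (colen (ideal_pow I t)) / real t ^ card P) \<longlonglongrightarrow> e" "e \<le> real (colen I)"
proof -
  define g where "g t = colen (ideal_pow I t)" for t
  have "mono g"
  proof (rule monoI)
    fix s t :: nat assume "s \<le> t"
    then show "g s \<le> g t"
      unfolding g_def using J_subset_ideal_pow[OF I, of t] ideal_pow_antimono[OF I(1)]
      by (auto intro: colen_antimono[OF ideal_ideal_pow[OF I(1)]])
  qed
  moreover have "g (s * t) \<le> s ^ card P * g t" if "s > 0" for s t
  proof -
    obtain N where "J N \<subseteq> ideal_pow I t" using J_subset_ideal_pow[OF I] by blast
    from colen_ideal_pow_le[OF ideal_ideal_pow[OF I(1)] this that]
    show ?thesis unfolding g_def by (simp add: mult.commute[of s t] ideal_pow_mult[OF I(1)])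
  qed
  ultimately obtain e :: real where e: "(\<lambda>t. real (g t) / real t ^ card P) \<longlonglongrightarrow> e" "e \<le> real (g 1)"
    by (rule submultiplicative_limit)
  have length: "module_length R (quot_module R (ideal_pow I t)) = enat (g t)" for t
    unfolding g_def using J_subset_ideal_pow[OF I, of t] module_length_eq_colen ideal_ideal_pow[OF I(1)]
    by blast
  have "(\<lambda>t. ereal (fact (card P) * (real (g t) / real t ^ card P))) \<longlonglongrightarrow> ereal (fact (card P) * e)"
    by (intro tendsto_intros e)
  then have "(\<lambda>t. ereal_of_enat (enat (g t)) / ereal (real t ^ card P / fact (card P)))
      \<longlonglongrightarrow> ereal (fact (card P) * e)"
  proof (rule Lim_transform_eventually)
    show "eventually (\<lambda>t. ereal (fact (card P) * (real (g t) / real t ^ card P)) =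
        ereal_of_enat (enat (g t)) / ereal (real t ^ card P / fact (card P))) sequentially"
      using eventually_gt_at_top[of 0] by eventually_elim simp
  qed
  \<comment> \<open>Convergence has been established, so \<open>lim\<close> in the definition of the
    multiplicity denotes a genuine limit.\<close>
  then have "hs_multiplicity R I = ereal (fact (card P) * e)"
    unfolding hs_multiplicity_def Let_def assms(3) length the_enat.simps by (rule limI)
  moreover have "g 1 = colen I" unfolding g_def using ideal_pow_1[OF I(1)] by simp
  ultimately show thesis using that e unfolding g_def by metis
qed

text \<open>The embedding dimension equals \<open>n\<close> by regularity. A finite infimum in
  \<open>enat\<close> is taken over a nonempty set and is therefore attained.\<close>

lemma regular_system_of_parameters:
  assumes "regular_local_ring R" "krull_dim R = enat n"
  obtains S where "finite S" "card S = n" "S \<subseteq> carrier R" "genideal R S = max_ideal R"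
proof -
  let ?E = "{enat (card S) | S. finite S \<and> S \<subseteq> carrier R \<and> genideal R S = max_ideal R}"
  have Inf: "Inf ?E = enat n"
    using assms by (simp add: regular_local_ring_def embedding_dim_def)
  then have "?E \<noteq> {}" by (metis Inf_empty enat.distinct(1) top_enat_def)
  then have "Inf ?E \<in> ?E" unfolding Inf_enat_def by (auto intro: LeastI)
  then show thesis using that unfolding Inf by auto
qed

section \<open>Valuation ideals\<close>

context rank_one_centered_valuation
begin

context
  fixes A
  defines "A \<equiv> K\<lparr>carrier := R\<rparr>"
  assumes subring_R: "subring R K" and cring_A: "cring A"
begin

interpretation A: cring A by (rule cring_A)

lemma R_subset: "x \<in> R \<Longrightarrow> x \<in> carrier K"
  using subring_R subringE(1) by blast

lemma A_simps: "carrier A = R" "x \<otimes>\<^bsub>A\<^esub> y = x \<otimes> y" "x \<oplus>\<^bsub>A\<^esub> y = x \<oplus> y" "\<zero>\<^bsub>A\<^esub> = \<zero>" "\<one>\<^bsub>A\<^esub> = \<one>"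
  by (simp_all add: A_def)

lemma ideal_val_ideal: "ideal (val_ideal A \<nu> m) A"
proof -
  have mult: "x \<otimes>\<^bsub>A\<^esub> a \<in> val_ideal A \<nu> m" if "x \<in> carrier A" "a \<in> val_ideal A \<nu> m" for x a
  proof -
    have "ereal m \<le> \<nu> x + \<nu> a"
      using add_mono[of 0 "\<nu> x" "ereal m" "\<nu> a"] that nonneg_on_ring
      by (simp add: val_ideal_def A_simps)
    then show ?thesis using that A.m_closed[of x a] val_mult R_subset
      by (simp add: val_ideal_def A_simps)
  qed
  show ?thesis
  proof (rule idealI)
    show "subgroup (val_ideal A \<nu> m) (add_monoid A)"
    proof (rule A.add.subgroupI)
      have "\<zero>\<^bsub>A\<^esub> \<in> val_ideal A \<nu> m"
        using A.zero_closed by (simp add: val_ideal_def A_simps val_zero)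
      then show "val_ideal A \<nu> m \<noteq> {}" by blast
      \<comment> \<open>Negation is multiplication by the ring element \<open>-1\<close>, which is
        already covered by \<open>mult\<close>.\<close>
      show "\<ominus>\<^bsub>A\<^esub> a \<in> val_ideal A \<nu> m" if "a \<in> val_ideal A \<nu> m" for a
        using mult[of "\<ominus>\<^bsub>A\<^esub> \<one>\<^bsub>A\<^esub>" a] that by (simp add: A.l_minus val_ideal_def)
      show "a \<oplus>\<^bsub>A\<^esub> b \<in> val_ideal A \<nu> m" if "a \<in> val_ideal A \<nu> m" "b \<in> val_ideal A \<nu> m" for a b
      proof -
        have "ereal m \<le> min (\<nu> a) (\<nu> b)" using that by (simp add: val_ideal_def)
        also have "\<dots> \<le> \<nu> (a \<oplus> b)"
          using that by (intro val_add R_subset) (auto simp: val_ideal_def A_simps)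
        finally show ?thesis
          using that A.a_closed[of a b] by (simp add: val_ideal_def A_simps)
      qed
    qed (simp add: val_ideal_def)
    show "x \<otimes>\<^bsub>A\<^esub> a \<in> val_ideal A \<nu> m" if "a \<in> val_ideal A \<nu> m" "x \<in> carrier A" for a x
      using mult that by blast
    then show "a \<otimes>\<^bsub>A\<^esub> x \<in> val_ideal A \<nu> m" if "a \<in> val_ideal A \<nu> m" "x \<in> carrier A" for a x
      using that A.m_comm[of a x] by (simp add: val_ideal_def)
  qed (rule A.ring_axioms)
qed

lemma val_ideal_antimono: "m \<le> m' \<Longrightarrow> val_ideal A \<nu> m' \<subseteq> val_ideal A \<nu> m"
  by (auto simp: val_ideal_def intro: order_trans[of "ereal m" "ereal m'"])

lemma val_ideal_0: "val_ideal A \<nu> 0 = carrier A"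
  using nonneg_on_ring by (auto simp: val_ideal_def A_simps zero_ereal_def[symmetric])

lemma val_ideal_prod: "val_ideal A \<nu> m \<cdot>\<^bsub>A\<^esub> val_ideal A \<nu> m' \<subseteq> val_ideal A \<nu> (m + m')"
proof
  interpret I: ideal "val_ideal A \<nu> (m + m')" A by (rule ideal_val_ideal)
  fix x assume "x \<in> val_ideal A \<nu> m \<cdot>\<^bsub>A\<^esub> val_ideal A \<nu> m'"
  then show "x \<in> val_ideal A \<nu> (m + m')"
  proof (induction rule: ideal_prod.induct)
    case (prod a b)
    then have "ereal m \<le> \<nu> a" "ereal m' \<le> \<nu> b"
      unfolding val_ideal_def by blast+
    then have "ereal m + ereal m' \<le> \<nu> a + \<nu> b" by (rule add_mono)
    then show ?case using prod A.m_closed[of a b] val_mult[of a b] R_subset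
      by (simp add: val_ideal_def A_simps)
  qed auto
qed

lemma val_ideal_pow: "val_ideal A \<nu> m [^]\<^bsub>ideals_set A\<^esub> t \<subseteq> val_ideal A \<nu> (real t * m)"
proof (induction t)
  case 0
  then show ?case by (simp add: val_ideal_0)
next
  case (Suc t)
  have "(val_ideal A \<nu> m [^]\<^bsub>ideals_set A\<^esub> t) \<cdot>\<^bsub>A\<^esub> val_ideal A \<nu> m \<subseteq>
      val_ideal A \<nu> (real t * m) \<cdot>\<^bsub>A\<^esub> val_ideal A \<nu> m"
  proof
    fix x assume "x \<in> (val_ideal A \<nu> m [^]\<^bsub>ideals_set A\<^esub> t) \<cdot>\<^bsub>A\<^esub> val_ideal A \<nu> m"
    then show "x \<in> val_ideal A \<nu> (real t * m) \<cdot>\<^bsub>A\<^esub> val_ideal A \<nu> m"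
      by (induction rule: ideal_prod.induct) (use Suc in \<open>auto intro: ideal_prod.intros\<close>)
  qed
  also have "\<dots> \<subseteq> val_ideal A \<nu> (real t * m + m)" by (rule val_ideal_prod)
  finally show ?case by (simp add: algebra_simps)
qed

text \<open>The generators have values at least some \<open>\<delta> > 0\<close>. If no prime in
  \<open>P\<close> exceeds \<open>B\<close>, a smooth number \<open>b \<ge> B ^ c\<close> has at
  least \<open>c\<close> prime factors with multiplicity, so \<open>mon b\<close> has value at least
  \<open>c * \<delta>\<close>. This exceeds any given \<open>m\<close> for large
  \<open>c\<close>.\<close>

lemma J_subset_val_ideal:
  assumes "local_ring_generators A P y (max_ideal A)"
  shows "\<exists>N. local_ring_generators.J A P y N \<subseteq> val_ideal A \<nu> m"
proof -
  interpret G: local_ring_generators A P y "max_ideal A" by fact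
  have y_pos: "0 < \<nu> (y p)" if "p \<in> P" for p
  proof -
    have "y ` P \<subseteq> max_ideal A"
      unfolding G.M_eq using G.y_closed by (intro A.genideal_self) auto
    then show ?thesis using pos_on_max_ideal that unfolding A_def by blast
  qed
  \<comment> \<open>Inserting 1 covers empty \<open>P\<close> and keeps \<open>d\<close> finite even
    if all \<open>\<nu> (y p)\<close> are infinite.\<close>
  define d where "d = Min (insert 1 ((\<lambda>p. \<nu> (y p)) ` P))"
  have d: "0 < d" "d \<le> 1" "\<And>p. p \<in> P \<Longrightarrow> d \<le> \<nu> (y p)"
    using G.finite_P y_pos by (auto simp: d_def)
  then obtain \<delta> where \<delta>: "d = ereal \<delta>" "\<delta> > 0" by (cases d) auto
  \<comment> \<open>Inserting 2 covers empty \<open>P\<close> and makes \<open>B ^ Suc c\<close>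
    greater than 1, so that the \<open>b\<close> of the induction step has a prime factor.\<close>
  define B where "B = Max (insert 2 P)"
  have B: "2 \<le> B" "\<And>p. p \<in> P \<Longrightarrow> p \<le> B" using G.finite_P by (auto simp: B_def)
  have val_mon: "ereal (real c * \<delta>) \<le> \<nu> (G.mon b)" if "b \<in> G.smooth" "B ^ c \<le> b" for b c
    using that
  proof (induction c arbitrary: b)
    case 0
    then show ?case
      using nonneg_on_ring G.mon_closed[of b] by (simp add: A_simps zero_ereal_def[symmetric])
  next
    case (Suc c)
    have "1 < b" using B(1) Suc(3) one_less_power[of B "Suc c"] by simp
    then obtain p where p: "Factorial_Ring.prime p" "p dvd b"
      using prime_factor_nat[of b] by auto
    then obtain b' where b': "b = p * b'" by blast
    have "p \<in> prime_factors b" using p \<open>1 < b\<close> by (simp add: in_prime_factors_iff)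
    then have "p \<in> P" using Suc by (auto simp: G.smooth_def)
    have "b' > 0" using b' \<open>1 < b\<close> by (cases b') auto
    have "prime_factors b' \<subseteq> prime_factors b"
      using b' \<open>b' > 0\<close> prime_gt_0_nat[OF p(1)] by (intro dvd_prime_factors) auto
    then have "b' \<in> G.smooth" using Suc(2) \<open>b' > 0\<close> by (auto simp: G.smooth_def)
    \<comment> \<open>Removing one prime factor divides \<open>b\<close> by at most
      \<open>B\<close>.\<close>
    moreover have "B ^ c \<le> b'"
    proof -
      have "B * B ^ c \<le> p * b'" using Suc(3) b' by simp
      also have "\<dots> \<le> B * b'" using B(2)[OF \<open>p \<in> P\<close>] by simp
      finally show ?thesis using B(1) by simp
    qed
    ultimately have "ereal (real c * \<delta>) \<le> \<nu> (G.mon b')" by (rule Suc.IH)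
    moreover have "ereal \<delta> \<le> \<nu> (y p)" using d(3)[OF \<open>p \<in> P\<close>] \<delta> by simp
    ultimately have "ereal \<delta> + ereal (real c * \<delta>) \<le> \<nu> (y p) + \<nu> (G.mon b')"
      by (intro add_mono)
    also have "\<dots> = \<nu> (y p \<otimes> G.mon b')"
      using G.y_closed[OF \<open>p \<in> P\<close>] G.mon_closed[of b'] R_subset
      by (intro val_mult[symmetric]) (auto simp: A_simps)
    also have "y p \<otimes> G.mon b' = G.mon b"
      using G.mon_mult[of p b'] G.mon_prime[OF \<open>p \<in> P\<close>] \<open>b' > 0\<close> p b'
      by (simp add: A_simps prime_gt_0_nat)
    finally show ?case by (simp add: algebra_simps)
  qed
  obtain c :: nat where c: "m \<le> real c * \<delta>"
    using reals_Archimedean3[OF \<delta>(2)] by (meson less_imp_le)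
  have "G.J (B ^ c) \<subseteq> val_ideal A \<nu> m"
  proof (rule G.J_minimal[OF ideal_val_ideal])
    fix b assume "b \<in> G.smooth" "B ^ c \<le> b"
    then have "ereal m \<le> \<nu> (G.mon b)" using val_mon c by (meson ereal_less_eq(3) order_trans)
    then show "G.mon b \<in> val_ideal A \<nu> m" by (simp add: val_ideal_def)
  qed
  then show ?thesis by blast
qed

end

end

theorem corollaryC:
  fixes K :: "('a, 'm) ring_scheme" and k R :: "'a set" and \<nu> :: "'a \<Rightarrow> ereal" and n :: nat
  assumes "field K"
    and "subfield k K" and "char_zero (K\<lparr>carrier := k\<rparr>)"
    and "subring R K" and "k \<subseteq> R" and "is_fraction_field K R"
    and "regular_local_ring (K\<lparr>carrier := R\<rparr>)"
    and "ess_finite_type k (K\<lparr>carrier := R\<rparr>)"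
    and "krull_dim (K\<lparr>carrier := R\<rparr>) = enat n"
    and "rank_one_centered_valuation K \<nu> k R"
    and "abhyankar K k \<nu>"
  shows "((\<lambda>m. hs_multiplicity (K\<lparr>carrier := R\<rparr>) (val_ideal (K\<lparr>carrier := R\<rparr>) \<nu> m) / ereal (m ^ n))
           \<longlongrightarrow> volume (K\<lparr>carrier := R\<rparr>) \<nu>) (values_at_top (K\<lparr>carrier := R\<rparr>) \<nu>)"
proof -
  define A where "A = K\<lparr>carrier := R\<rparr>"
  interpret V: rank_one_centered_valuation K \<nu> k R by fact
  have A: "noetherian_ring A" "local_ring A" "krull_dim A = enat n"
    using assms(7,9) by (simp_all add: A_def regular_local_ring_def)
  then interpret A: cring A by (simp add: local_ring_def)
  have cring: "cring (K\<lparr>carrier := R\<rparr>)" using A.is_cring by (simp add: A_def)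
  note val_facts = V.ideal_val_ideal[OF assms(4) cring] V.val_ideal_antimono[OF assms(4) cring]
    V.val_ideal_pow[OF assms(4) cring] V.J_subset_val_ideal[OF assms(4) cring]
  note val_facts = val_facts[folded A_def]
  obtain S where S: "finite S" "card S = n" "S \<subseteq> carrier A" "genideal A S = max_ideal A"
    using regular_system_of_parameters assms(7,9) unfolding A_def by metis
  \<comment> \<open>These primes index the \<open>n\<close> generators of the maximal ideal.\<close>
  obtain P :: "nat set" where P: "finite P" "card P = n" "P \<subseteq> {p. Factorial_Ring.prime p}"
    using infinite_arbitrarily_large[OF primes_infinite] by metis
  obtain y where y: "bij_betw y P S"
    using finite_same_card_bij[of P S] P S by auto
  interpret G: local_ring_generators A P y "max_ideal A"
  proof unfold_locales
    show "max_ideal A = genideal A (y ` P)" using S y by (simp add: bij_betw_def)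
  qed (use P S y A local_ring_unit in \<open>auto simp: bij_betw_def\<close>)
  let ?a = "val_ideal A \<nu>"
  note J_sub = val_facts(4)[OF G.local_ring_generators_axioms]
  have "\<exists>e. hs_multiplicity A (?a m) = ereal (fact n * e) \<and>
      (\<lambda>t. real (G.colen (G.ideal_pow (?a m) t)) / real t ^ n) \<longlonglongrightarrow> e \<and> e \<le> real (G.colen (?a m))"
    (is "\<exists>e. ?Q m e") for m
  proof -
    obtain N where "G.J N \<subseteq> ?a m" using J_sub by blast
    then obtain e where "hs_multiplicity A (?a m) = ereal (fact n * e)"
      "(\<lambda>t. real (G.colen (G.ideal_pow (?a m) t)) / real t ^ n) \<longlonglongrightarrow> e" "e \<le> real (G.colen (?a m))"
      by (rule G.multiplicity_eq_limit[OF val_facts(1), unfolded P(2), OF _ A(3)])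
    then show ?thesis by blast
  qed
  then obtain e where "\<And>m. ?Q m (e m)"
    using choice[of ?Q] by blast
  then have e: "\<And>m. hs_multiplicity A (?a m) = ereal (fact n * e m)"
      "\<And>m. (\<lambda>t. real (G.colen (G.ideal_pow (?a m) t)) / real t ^ n) \<longlonglongrightarrow> e m"
      "\<And>m. e m \<le> real (G.colen (?a m))"
    by blast+
  \<comment> \<open>If \<open>x \<le> t * m\<close>, then \<open>\<aa>\<^sub>m\<^sup>t \<subseteq>
    \<aa>\<^sub>t\<^sub>m \<subseteq> \<aa>\<^sub>x\<close>, and colength reverses
    inclusions.\<close>
  have colen_le: "real (G.colen (?a x)) \<le> real (G.colen (G.ideal_pow (?a m) t))" if "x \<le> real t * m" for x m t
  proof -
    obtain N where "G.J N \<subseteq> ?a m" using J_sub by blast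
    then obtain N' where "G.J N' \<subseteq> G.ideal_pow (?a m) t"
      using G.J_subset_ideal_pow[OF val_facts(1)] by blast
    moreover have "G.ideal_pow (?a m) t \<subseteq> ?a x"
      using val_facts(3)[of m t] val_facts(2)[OF that] by blast
    ultimately show ?thesis
      using G.colen_antimono[OF G.ideal_ideal_pow[OF val_facts(1)]] by simp
  qed
  let ?F = "values_at_top A \<nu>"
  \<comment> \<open>Positive \<open>m\<close> makes \<open>m ^ n\<close> nonzero, which justifies
    rearranging the quotients of extended reals below.\<close>
  have pos: "eventually (\<lambda>m. m > 0) ?F"
    unfolding values_at_top_def by (rule filter_leD[OF inf_le1 eventually_gt_at_top])
  have length: "module_length A (quot_module A (?a m)) = enat (G.colen (?a m))" for m
    using J_sub G.module_length_eq_colen[OF val_facts(1)] by blast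
  have vol: "volume A \<nu> = Limsup ?F (\<lambda>m. ereal (fact n * real (G.colen (?a m)) / m ^ n))"
    unfolding volume_def Let_def A(3) the_enat.simps length
  proof (rule Limsup_eq)
    show "eventually (\<lambda>m. ereal_of_enat (enat (G.colen (?a m))) / ereal (m ^ n / fact n) =
        ereal (fact n * real (G.colen (?a m)) / m ^ n)) ?F"
      using pos by eventually_elim simp
  qed
  have "((\<lambda>m. ereal (fact n * e m / m ^ n)) \<longlongrightarrow> volume A \<nu>) ?F"
    unfolding vol values_at_top_def
    by (rule volume_squeeze[where G = "\<lambda>m t. real (G.colen (G.ideal_pow (?a m) t))"])
      (use e colen_le in auto)
  then have "((\<lambda>m. hs_multiplicity A (?a m) / ereal (m ^ n)) \<longlongrightarrow> volume A \<nu>) ?F"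
  proof (rule Lim_transform_eventually)
    show "eventually (\<lambda>m. ereal (fact n * e m / m ^ n) = hs_multiplicity A (?a m) / ereal (m ^ n)) ?F"
      using pos by eventually_elim (simp add: e(1))
  qed
  then show ?thesis unfolding A_def .
qed

end
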